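(* For every strict poset kernel $(S,\mathcal{F},\mu,\vartriangleleft,W)$ such that $(S,\mathcal{F},\mu)$ is atomless, there is a poset kernel $([0,1],\mathcal{B},\lambda,<,U)$, where $\mathcal{B}$ is the Borel $\sigma$-algebra of $[0,1]$, $\lambda$ is the Lebesgue measure and $<$ is the standard order, and an inclusion $f:(S,\mathcal{F},\mu,\vartriangleleft)\to([0,1],\mathcal{B},\lambda,<)$ such that $W$ is equal to the pull-back $U^f$ almost everywhere (on $S\times S$ with respect to $\mu\otimes\mu$).
   Context: An ordered probability space $(S,\mathcal{F},\mu,\vartriangleleft)$ is a probability space $(S,\mathcal{F},\mu)$ equipped with a strict order relation $\vartriangleleft$ on $S$ (transitive and irreflexive) such that $\{(x,y): x\vartriangleleft y\}\in\mathcal{F}\otimes\mathcal{F}$ (the product $\sigma$-algebra). A (poset) kernel is a 5-tuple $(S,\mathcal{F},\mu,\vartriangleleft,W)$ where $(S,\mathcal{F},\mu,\vartriangleleft)$ is an ordered probability space and $W:S\times S\to[0,1]$ is $\mathcal{F}\otimes\mathcal{F}$-measurable and satisfies, for all $x,y,z\in S$: (i) $W(x,y)>0\Rightarrow x\vartriangleleft y$; (ii) $W(x,y)>0$ and $W(y,z)>0$ $\Rightarrow$ $W(x,z)=1$. The kernel is strict if $W(x,y)>0$ for all $x,y\in S$ with $x\vartriangleleft y$. A function $f:S\to S'$ between probability spaces $(S,\mathcal{F},\mu)$ and $(S',\mathcal{F}',\mu')$ is measure-preserving if it is $(\mathcal{F},\mathcal{F}')$-measurable and $\mu(f^{-1}(A))=\mu'(A)$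 for every $A\in\mathcal{F}'$. An inclusion between ordered probability spaces $(S,\mathcal{F},\mu,\vartriangleleft)$ and $(S',\mathcal{F}',\mu',\vartriangleleft')$ is a measure-preserving function $f:S\to S'$ such that the set $\{(x,y)\in S^2: x\vartriangleleft y,\ f(x)\not\vartriangleleft' f(y)\}$ has $\mu\otimes\mu$-measure zero. The pull-back of $U:S'\times S'\to[0,1]$ along $f$ is $U^f:S^2\to[0,1]$, $U^f(x,y):=U(f(x),f(y))$. *)

theory Defs
  imports "HOL-Probability.Probability"
begin

text \<open>
  The underlying set of a space is \<open>space M\<close>, which may be a proper subset of the type; orders and
  kernels are total functions on the type of which only the values on \<open>space M\<close> matter.
\<close>

locale ordered_prob_space = prob_space M for M :: "'a measure" +
  fixes lt :: "'a \<Rightarrow> 'a \<Rightarrow> bool"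
  assumes transp_lt: "transp_on (space M) lt"
    and irreflp_lt: "irreflp_on (space M) lt"
    and sets_lt: "{(x, y). x \<in> space M \<and> y \<in> space M \<and> lt x y} \<in> sets (M \<Otimes>\<^sub>M M)"

locale poset_kernel = ordered_prob_space M lt
  for M :: "'a measure" and lt :: "'a \<Rightarrow> 'a \<Rightarrow> bool" +
  fixes W :: "'a \<Rightarrow> 'a \<Rightarrow> real"
  assumes kernel_range: "\<And>x y. x \<in> space M \<Longrightarrow> y \<in> space M \<Longrightarrow> W x y \<in> {0..1}"
    and kernel_measurable: "(\<lambda>(x, y). W x y) \<in> borel_measurable (M \<Otimes>\<^sub>M M)"
    and kernel_pos_imp_lt:
      "\<And>x y. x \<in> space M \<Longrightarrow> y \<in> space M \<Longrightarrow> W x y > 0 \<Longrightarrow> lt x y"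
    and kernel_trans:
      "\<And>x y z. x \<in> space M \<Longrightarrow> y \<in> space M \<Longrightarrow> z \<in> space M \<Longrightarrow>
        W x y > 0 \<Longrightarrow> W y z > 0 \<Longrightarrow> W x z = 1"

locale strict_poset_kernel = poset_kernel +
  assumes kernel_strict:
    "\<And>x y. x \<in> space M \<Longrightarrow> y \<in> space M \<Longrightarrow> lt x y \<Longrightarrow> W x y > 0"

definition atomless :: "'a measure \<Rightarrow> bool" where
  "atomless M \<longleftrightarrow>
    (\<forall>A\<in>sets M. emeasure M A > 0 \<longrightarrow>
      (\<exists>B\<in>sets M. B \<subseteq> A \<and> 0 < emeasure M B \<and> emeasure M B < emeasure M A))"

definition measure_preserving :: "'a measure \<Rightarrow> 'b measure \<Rightarrow> ('a \<Rightarrow> 'b) \<Rightarrow> bool" where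
  "measure_preserving M N f \<longleftrightarrow>
    f \<in> measurable M N \<and> (\<forall>A\<in>sets N. emeasure M (f -` A \<inter> space M) = emeasure N A)"

definition poset_inclusion ::
  "'a measure \<Rightarrow> ('a \<Rightarrow> 'a \<Rightarrow> bool) \<Rightarrow> 'b measure \<Rightarrow> ('b \<Rightarrow> 'b \<Rightarrow> bool) \<Rightarrow> ('a \<Rightarrow> 'b) \<Rightarrow> bool" where
  "poset_inclusion M lt N lt' f \<longleftrightarrow>
    ordered_prob_space M lt \<and> ordered_prob_space N lt' \<and> measure_preserving M N f \<and>
    {(x, y). x \<in> space M \<and> y \<in> space M \<and> lt x y \<and> \<not> lt' (f x) (f y)} \<in> null_sets (M \<Otimes>\<^sub>M M)"

definition pull_back :: "('b \<Rightarrow> 'b \<Rightarrow> real) \<Rightarrow> ('a \<Rightarrow> 'b) \<Rightarrow> 'a \<Rightarrow> 'a \<Rightarrow> real" where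
  "pull_back U f x y = U (f x) (f y)"

text \<open>
  The \<open>\<sigma>\<close>-algebra consists of the Borel subsets of the interval, since \<open>lborel\<close> (unlike
  \<open>lebesgue\<close>) is Lebesgue measure on the Borel sets.
\<close>

abbreviation unit_interval :: "real measure" where
  "unit_interval \<equiv> restrict_space lborel {0..1}"

end

theory Submission
  imports Defs
begin

text \<open>
  Strictness makes every section \<open>W x _\<close> increasing and \<open>W _ y\<close> decreasing, so all their level sets are
  lower sets (or complements of such). By separability of the sections in \<open>L\<^sup>1\<close>, a sequence \<open>L\<close> of
  lower sets resolves all of them; its ternary code is a monotone real function, which is completed
  to a uniform monotone variable \<open>f\<close> by breaking ties with a diffuse variable. Adding the sublevel sets of
  \<open>depth y = \<mu> {x. x \<lhd> y}\<close> to \<open>L\<close> makes \<open>f\<close> strictly monotone almost everywhere, as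
  \<open>x \<lhd> y\<close> with equal depths happens on a null set only.

  The averages of \<open>W\<close> over the cells \<open>f -` [i/n, (i+1)/n)\<close>, as functions on the square of \<open>[0,1]\<close>,
  then converge almost everywhere to \<open>W\<close> along a subsequence. Let \<open>U s t\<close> be their limit at those
  points where the density of \<open>{W > 0}\<close> in the cells tends to 1, and 0 elsewhere. If the density
  of \<open>{W > 0}\<close> tends to 1 at \<open>(s, t)\<close> and at \<open>(t, u)\<close>, then \<open>W\<close> averages to nearly 1 at
  \<open>(s, u)\<close>, so \<open>U\<close> satisfies the kernel axiom everywhere and not just almost everywhere.
\<close>

subsection \<open>A ternary code for sequences of sets\<close>

text \<open>The space carries no topology and its \<sigma>-algebra may be far from countably
  generated, while the target order is total. One real variable has to extend the order almost
  everywhere and, at the same time, determine uncountably many sections of \<open>W\<close> up to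
  null sets. That all relevant level sets respect the order is what makes these two demands
  compatible. Conditional expectations and Lebesgue differentiation are replaced by the mean
  oscillation inside cells. It can be checked for one section at a time, because the joint
  oscillation is bounded by those of the sections in the two variables. The kernel axiom concerns
  all triples of points, whereas \<open>W\<close> is recovered only almost everywhere, so
  \<open>U\<close> cannot be an arbitrary almost everywhere limit. Full density is a condition on
  individual points of the square, and it passes from \<open>(s, t)\<close> and
  \<open>(t, u)\<close> to \<open>(s, u)\<close>. It is the density of \<open>{W > 0}\<close> that
  is tested, not the average of \<open>W\<close>, because positive values of \<open>W\<close> may
  well be smaller than 1.\<close>

definition ternary_code :: "(nat \<Rightarrow> 'a set) \<Rightarrow> 'a \<Rightarrow> real" where
  "ternary_code L x = (\<Sum>i. (1/3) ^ Suc i * of_bool (x \<notin> L i))"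

lemma summable_ternary_code: "summable (\<lambda>i. (1/3::real) ^ Suc i * of_bool (P i))"
  by (rule summable_comparison_test[of _ "\<lambda>i. (1/3) ^ i"]) (auto intro!: exI[of _ 0] simp: summable_geometric)

lemma ternary_code_rec:
  "ternary_code L x = (of_bool (x \<notin> L 0) + ternary_code (\<lambda>i. L (Suc i)) x) / 3"
proof -
  have "ternary_code L x = (\<Sum>i. (1/3) ^ Suc (Suc i) * of_bool (x \<notin> L (Suc i))) + of_bool (x \<notin> L 0) / 3"
    unfolding ternary_code_def
    using suminf_split_initial_segment[OF summable_ternary_code[of "\<lambda>i. x \<notin> L i"], of 1] by simp
  also have "(\<Sum>i. (1/3::real) ^ Suc (Suc i) * of_bool (x \<notin> L (Suc i)))
      = (\<Sum>i. (1/3) ^ Suc i * of_bool (x \<notin> L (Suc i))) / 3"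
    by (subst suminf_divide[OF summable_ternary_code, symmetric]) simp
  finally show ?thesis
    unfolding ternary_code_def by simp
qed

lemma ternary_code_nonneg: "0 \<le> ternary_code L x"
  unfolding ternary_code_def by (intro suminf_nonneg summable_ternary_code) auto

lemma ternary_code_le: "ternary_code L x \<le> 1/2"
proof -
  have s: "(\<lambda>i. (1/3::real) * (1/3) ^ i) sums ((1/3) * (1 / (1 - 1/3)))"
    by (intro sums_mult geometric_sums) simp
  have "ternary_code L x \<le> (\<Sum>i. (1/3) * (1/3) ^ i)"
    unfolding ternary_code_def using s
    by (intro suminf_le summable_ternary_code) (auto simp: sums_iff)
  then show ?thesis using s by (simp add: sums_iff)
qed

text \<open>The digit 1 marks the points outside \<open>L i\<close>; with this orientation lower
  sets yield a code that increases along the order.\<close>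

lemma ternary_code_mono:
  assumes "\<And>i. y \<in> L i \<Longrightarrow> x \<in> L i"
  shows "ternary_code L x \<le> ternary_code L y"
  unfolding ternary_code_def using assms
  by (intro suminf_le summable_ternary_code) (auto simp: of_bool_def)

lemma borel_measurable_ternary_code:
  assumes "\<And>i. L i \<in> sets M"
  shows "ternary_code L \<in> borel_measurable M"
proof -
  have [measurable]: "L i \<in> sets M" for i by fact
  show ?thesis
    unfolding ternary_code_def[abs_def] by measurable
qed

text \<open>Base 3 is used with the digits 0 and 1 only: the later digits contribute at most 1/6, so
  the code is at most 1/6 on \<open>L 0\<close> and at least 1/3 off it. In base 2 a tail of ones
  would reach the threshold and spoil the reading of the digit.\<close>

lemma ternary_code_first_digit: "x \<in> L 0 \<longleftrightarrow> ternary_code L x < 1/3"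
proof -
  define t where "t = ternary_code (\<lambda>i. L (Suc i)) x"
  have "ternary_code L x = (of_bool (x \<notin> L 0) + t) / 3" "0 \<le> t" "t \<le> 1/2"
    unfolding t_def by (rule ternary_code_rec ternary_code_nonneg ternary_code_le)+
  then show ?thesis by (cases "x \<in> L 0") auto
qed

lemma ternary_code_tail:
  "ternary_code (\<lambda>i. L (Suc i)) x = 3 * ternary_code L x - of_bool (\<not> ternary_code L x < 1/3)"
proof -
  define t where "t = ternary_code (\<lambda>i. L (Suc i)) x"
  have "ternary_code L x = (of_bool (x \<notin> L 0) + t) / 3"
    unfolding t_def by (rule ternary_code_rec)
  then show ?thesis
    unfolding t_def[symmetric] ternary_code_first_digit[of x L, symmetric] by simp
qed

text \<open>Converse to the measurability of the code: the first digit is read off by a threshold,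
  the others after shifting it away. \<open>N\<close> is an arbitrary measure space, so that a
  \<sigma>-algebra smaller than that of \<open>M\<close> can be inserted later.\<close>

lemma sets_ternary_code_digit:
  assumes "ternary_code L \<in> borel_measurable N"
  shows "L i \<inter> space N \<in> sets N"
  using assms
proof (induction i arbitrary: L)
  case 0
  note [measurable] = 0
  have "L 0 \<inter> space N = {x \<in> space N. ternary_code L x < 1/3}"
    using ternary_code_first_digit[of _ L] by auto
  then show ?case by simp
next
  case (Suc i)
  note [measurable] = Suc.prems
  have "ternary_code (\<lambda>i. L (Suc i)) \<in> borel_measurable N"
    unfolding ternary_code_tail[abs_def] by measurable
  from Suc.IH[OF this] show ?case .
qed

lemma ternary_code_eq_digit:
  assumes "ternary_code L x = ternary_code L y"
  shows "x \<in> L i \<longleftrightarrow> y \<in> L i"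
  using assms
proof (induction i arbitrary: L)
  case 0
  then show ?case by (simp add: ternary_code_first_digit)
next
  case (Suc i)
  have "ternary_code (\<lambda>i. L (Suc i)) x = ternary_code (\<lambda>i. L (Suc i)) y"
    unfolding ternary_code_tail Suc.prems ..
  from Suc.IH[OF this] show ?case .
qed

subsection \<open>Countably generated sections and small sets\<close>

text \<open>Countability comes from \<open>A\<close> and not from \<open>M\<close>, whose L1 space
  may be non-separable. In the induction on the generation of \<open>A\<close>, a rectangle has at
  most two sections, complementation carries a family over, and a section of a countable union is
  close to a finite union of approximants.\<close>

lemma (in prob_space) sections_approx_countable:
  assumes "A \<in> sets (M \<Otimes>\<^sub>M M)"
  shows "\<exists>\<D>. countable \<D> \<and> \<D> \<subseteq> sets M \<and>
    (\<forall>y\<in>space M. \<forall>e>0. \<exists>D\<in>\<D>. measure M (sym_diff ((\<lambda>x. (x, y)) -` A) D) < e)"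
    (is "?P A")
proof -
  have "A \<in> sigma_sets (space M \<times> space M) {a \<times> b | a b. a \<in> sets M \<and> b \<in> sets M}"
    using assms by (simp add: sets_pair_measure)
  then show ?thesis
  proof induction
    case (Basic A)
    then obtain a b where ab: "A = a \<times> b" "a \<in> sets M" "b \<in> sets M" by auto
    show ?case
      by (rule exI[of _ "{a, {}}"]) (use ab in auto)
  next
    case Empty
    show ?case by (rule exI[of _ "{{}}"]) auto
  next
    case (Compl A)
    then obtain \<D> where D: "countable \<D>" "\<D> \<subseteq> sets M"
      "\<And>y e. y \<in> space M \<Longrightarrow> e > 0 \<Longrightarrow> \<exists>D\<in>\<D>. measure M (sym_diff ((\<lambda>x. (x, y)) -` A) D) < e"
      by auto
    have A: "A \<in> sets (M \<Otimes>\<^sub>M M)" using Compl by (simp add: sets_pair_measure)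
    have eq: "sym_diff ((\<lambda>x. (x, y)) -` (space M \<times> space M - A)) (space M - D) = sym_diff ((\<lambda>x. (x, y)) -` A) D"
      if "D \<in> \<D>" "y \<in> space M" for D y
    proof -
      have "D \<subseteq> space M" using D(2) that sets.sets_into_space[of D M] by auto
      then show ?thesis
        using that sets.sets_into_space[OF A] by (auto simp: space_pair_measure)
    qed
    show ?case
    proof (rule exI[of _ "(\<lambda>D. space M - D) ` \<D>"], intro conjI ballI allI impI)
      fix y and e :: real assume y: "y \<in> space M" "e > 0"
      from D(3)[OF this] obtain X where X: "X \<in> \<D>" "measure M (sym_diff ((\<lambda>x. (x, y)) -` A) X) < e" by blast
      then show "\<exists>D\<in>(-) (space M) ` \<D>. measure M (sym_diff ((\<lambda>x. (x, y)) -` (space M \<times> space M - A)) D) < e"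
        by (intro bexI[of _ "space M - X"], subst eq[OF X(1) y(1)]) (use X in auto)
    qed (use D in auto)
  next
    case (Union A)
    define Q where "Q i \<D> \<longleftrightarrow> countable \<D> \<and> \<D> \<subseteq> sets M \<and>
        (\<forall>y\<in>space M. \<forall>e>0. \<exists>D\<in>\<D>. measure M (sym_diff ((\<lambda>x. (x, y)) -` A i) D) < e)" for i \<D>
    have "\<forall>i. \<exists>\<D>. Q i \<D>" unfolding Q_def using Union.IH by blast
    then obtain \<D> where Q: "\<And>i. Q i (\<D> i)" by metis
    have D: "countable (\<D> i)" "\<D> i \<subseteq> sets M"
      "\<And>y e. y \<in> space M \<Longrightarrow> e > 0 \<Longrightarrow> \<exists>D\<in>\<D> i. measure M (sym_diff ((\<lambda>x. (x, y)) -` A i) D) < e" for i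
      using Q[of i] unfolding Q_def by simp_all
    have A: "A i \<in> sets (M \<Otimes>\<^sub>M M)" for i using Union.hyps by (simp add: sets_pair_measure)
    define \<E> where "\<E> = Union ` {\<C>. finite \<C> \<and> \<C> \<subseteq> (\<Union>i. \<D> i)}"
    have "countable (\<Union>i. \<D> i)" using D by auto
    then have "countable \<E>"
      unfolding \<E>_def by (intro countable_image countable_Collect_finite_subset)
    moreover have "\<E> \<subseteq> sets M"
    proof -
      have "(\<Union>i. \<D> i) \<subseteq> sets M" using D(2) by (rule UN_least)
      then show ?thesis unfolding \<E>_def by (auto intro!: sets.finite_Union)
    qed
    moreover have "\<exists>D\<in>\<E>. measure M (sym_diff ((\<lambda>x. (x, y)) -` (\<Union>i. A i)) D) < e"
      if y: "y \<in> space M" "e > 0" for y e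
    proof -
      define B where "B i = (\<lambda>x. (x, y)) -` A i" for i
      have B[measurable]: "B i \<in> sets M" for i
        unfolding B_def using sets_Pair2[OF A] .
      have "(\<lambda>n. measure M (\<Union>i<n. B i)) \<longlonglongrightarrow> measure M (\<Union>n. \<Union>i<n. B i)"
        by (intro finite_Lim_measure_incseq monoI UN_mono) auto
      moreover have U: "(\<Union>n. \<Union>i<n. B i) = (\<Union>i. B i)" by auto
      ultimately have "\<exists>n. measure M (\<Union>i<n. B i) > measure M (\<Union>i. B i) - e/2"
        using y(2) by (intro eventually_happens'[OF sequentially_bot] order_tendstoD(1)) auto
      then obtain n where n: "measure M (\<Union>i. B i) - measure M (\<Union>i<n. B i) < e/2"
        by (metis diff_less_eq less_diff_eq add.commute)
      have n': "measure M ((\<Union>i. B i) - (\<Union>i<n. B i)) < e/2"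
        using n by (subst finite_measure_Diff) auto
      \<comment> \<open>The \<open>n\<close> errors add up to at most e/2, the other half being
        spent on cutting off the union at \<open>n\<close>. \<open>Suc n\<close> keeps
        \<open>d\<close> positive for \<open>n = 0\<close>.\<close>
      define d where "d = e / (2 * real (Suc n))"
      have "d > 0" using y by (simp add: d_def)
      then have "\<exists>X. \<forall>i. X i \<in> \<D> i \<and> measure M (sym_diff (B i) (X i)) < d"
        unfolding B_def using D(3)[OF y(1)] by (intro choice) blast
      then obtain X where X: "\<And>i. X i \<in> \<D> i" "\<And>i. measure M (sym_diff (B i) (X i)) < d" by auto
      have [measurable]: "X i \<in> sets M" for i using X(1)[of i] D(2)[of i] by auto
      have "measure M (sym_diff (\<Union>i. B i) (\<Union>i<n. X i))
        \<le> measure M (((\<Union>i. B i) - (\<Union>i<n. B i)) \<union> (\<Union>i<n. sym_diff (B i) (X i)))"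
        by (intro finite_measure_mono) auto
      also have "\<dots> \<le> measure M ((\<Union>i. B i) - (\<Union>i<n. B i)) + measure M (\<Union>i<n. sym_diff (B i) (X i))"
        by (intro measure_Un_le) auto
      also have "measure M (\<Union>i<n. sym_diff (B i) (X i)) \<le> (\<Sum>i<n. measure M (sym_diff (B i) (X i)))"
        by (intro measure_UNION_le) auto
      also have "(\<Sum>i<n. measure M (sym_diff (B i) (X i))) \<le> (\<Sum>i<n. d)"
        by (intro sum_mono less_imp_le X)
      also have "\<dots> \<le> e/2"
        unfolding d_def using y(2) by (simp add: field_simps)
      finally have "measure M (sym_diff (\<Union>i. B i) (\<Union>i<n. X i)) < e" using n' by linarith
      moreover have "(\<Union>i<n. X i) \<in> \<E>"
        unfolding \<E>_def using X by auto
      moreover have "(\<lambda>x. (x, y)) -` (\<Union>i. A i) = (\<Union>i. B i)" unfolding B_def by auto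
      ultimately show ?thesis by auto
    qed
    ultimately show ?case by blast
  qed
qed

text \<open>The preceding family consists of arbitrary measurable sets. It is replaced by sections
  of \<open>A\<close> themselves, at the cost of doubling the error, because the approximants will
  have to be lower sets.\<close>

lemma (in prob_space) sections_separable:
  assumes A: "A \<in> sets (M \<Otimes>\<^sub>M M)"
  shows "\<exists>Y. countable Y \<and> Y \<subseteq> space M \<and>
    (\<forall>y\<in>space M. \<forall>e>0. \<exists>y'\<in>Y. measure M (sym_diff ((\<lambda>x. (x, y)) -` A) ((\<lambda>x. (x, y')) -` A)) < e)"
proof -
  define B where "B y = (\<lambda>x. (x, y)) -` A" for y
  have B[measurable]: "B y \<in> sets M" for y unfolding B_def using sets_Pair2[OF A] .
  obtain \<D> where D: "countable \<D>" "\<D> \<subseteq> sets M"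
    "\<And>y e. y \<in> space M \<Longrightarrow> e > 0 \<Longrightarrow> \<exists>D\<in>\<D>. measure M (sym_diff (B y) D) < e"
    unfolding B_def using sections_approx_countable[OF A] by auto
  define Q where "Q = (\<lambda>(D, n) y. y \<in> space M \<and> measure M (sym_diff (B y) D) < 1 / real (Suc n))"
  \<comment> \<open>One section is picked for each pair of an approximant and a precision, provided
    that some section is that close to the approximant.\<close>
  define I where "I = {p \<in> \<D> \<times> UNIV. \<exists>y. Q p y}"
  define Y where "Y = (\<lambda>p. SOME y. Q p y) ` I"
  have Q: "Q p (SOME y. Q p y)" if "p \<in> I" for p
    using that unfolding I_def by (auto intro: someI_ex)
  have "countable I"
    unfolding I_def by (rule countable_subset[of _ "\<D> \<times> UNIV"]) (use D in auto)
  then have "countable Y" unfolding Y_def by simp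
  moreover have "Y \<subseteq> space M"
    unfolding Y_def using Q by (fastforce simp: Q_def split: prod.splits)
  moreover have "\<exists>y'\<in>Y. measure M (sym_diff (B y) (B y')) < e" if y: "y \<in> space M" "e > 0" for y e
  proof -
    obtain n where n: "1 / real (Suc n) < e / 2"
      using y(2) nat_approx_posE[of "e/2"] by auto
    obtain X where X: "X \<in> \<D>" "measure M (sym_diff (B y) X) < 1 / real (Suc n)"
      using D(3)[OF y(1), of "1 / real (Suc n)"] by auto
    have [measurable]: "X \<in> sets M" using X D by auto
    have I: "(X, n) \<in> I" unfolding I_def Q_def using X y by auto
    define y' where "y' = (SOME y. Q (X, n) y)"
    have y': "y' \<in> Y" unfolding Y_def y'_def using I by blast
    have "measure M (sym_diff (B y') X) < 1 / real (Suc n)"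
      using Q[OF I] unfolding y'_def by (simp add: Q_def)
    moreover have "measure M (sym_diff (B y) (B y')) \<le> measure M (sym_diff (B y) X \<union> sym_diff (B y') X)"
      by (intro finite_measure_mono) auto
    moreover have "\<dots> \<le> measure M (sym_diff (B y) X) + measure M (sym_diff (B y') X)"
      by (intro measure_Un_le) auto
    ultimately have "measure M (sym_diff (B y) (B y')) < e" using n X by linarith
    with y' show ?thesis by blast
  qed
  ultimately show ?thesis unfolding B_def by blast
qed

text \<open>Repeated halving: a set of positive measure splits into two parts of positive measure,
  and one of them has at most half the measure.\<close>

lemma (in prob_space) atomless_imp_small_subset:
  assumes "atomless M" "A \<in> sets M" "measure M A > 0" "e > 0"
  shows "\<exists>B\<in>sets M. B \<subseteq> A \<and> 0 < measure M B \<and> measure M B < e"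
proof -
  have half: "\<exists>B\<in>sets M. B \<subseteq> A \<and> 0 < measure M B \<and> measure M B \<le> measure M A / 2"
    if A: "A \<in> sets M" "measure M A > 0" for A
  proof -
    have "emeasure M A > 0" using A by (simp add: emeasure_eq_measure)
    then obtain B where "B \<in> sets M" "B \<subseteq> A" "0 < emeasure M B" "emeasure M B < emeasure M A"
      using assms(1) A(1) unfolding atomless_def by blast
    then have B: "B \<in> sets M" "B \<subseteq> A" "0 < measure M B" "measure M B < measure M A"
      by (auto simp: emeasure_eq_measure ennreal_less_iff)
    have "measure M (A - B) = measure M A - measure M B"
      using B A by (intro finite_measure_Diff) auto
    show ?thesis
    proof (cases "measure M B \<le> measure M A / 2")
      case True
      with B show ?thesis by blast
    next
      case False
      with B A \<open>measure M (A - B) = _\<close> show ?thesis by (intro bexI[of _ "A - B"]) auto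
    qed
  qed
  have "\<exists>B\<in>sets M. B \<subseteq> A \<and> 0 < measure M B \<and> measure M B \<le> (1/2) ^ n" for n
  proof (induction n)
    case 0
    show ?case using assms by (intro bexI[of _ A]) auto
  next
    case (Suc n)
    then obtain B where B: "B \<in> sets M" "B \<subseteq> A" "0 < measure M B" "measure M B \<le> (1/2) ^ n" by auto
    from half[OF B(1,3)] obtain C where "C \<in> sets M" "C \<subseteq> B" "0 < measure M C" "measure M C \<le> measure M B / 2" by auto
    with B show ?case by (intro bexI[of _ C]) auto
  qed
  moreover obtain n where "(1/2::real) ^ n < e" using real_arch_pow_inv[OF assms(4), of "1/2"] by auto
  ultimately show ?thesis by (meson le_less_trans)
qed

text \<open>Exhaustion: the supremum \<open>s\<close> of the measures covered by countable families
  of small sets is attained by uniting families that come within \<open>1 / (n + 1)\<close> of it. A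
  remainder of positive measure would contain a further small set, and adding it would exceed
  \<open>s\<close>.\<close>

lemma (in prob_space) atomless_imp_small_cover:
  assumes "atomless M" "e > 0"
  shows "\<exists>\<C>. countable \<C> \<and> \<C> \<subseteq> {B \<in> sets M. measure M B < e} \<and> measure M (space M - \<Union>\<C>) = 0"
proof -
  define \<K> where "\<K> = {\<C>. countable \<C> \<and> \<C> \<subseteq> {B \<in> sets M. measure M B < e}}"
  define s where "s = (SUP \<C>\<in>\<K>. measure M (\<Union>\<C>))"
  have ne: "{} \<in> \<K>" unfolding \<K>_def by simp
  have bdd: "bdd_above ((\<lambda>\<C>. measure M (\<Union>\<C>)) ` \<K>)" by (intro bdd_aboveI2[of _ _ 1]) simp
  have m[measurable]: "\<Union>\<C> \<in> sets M" if "\<C> \<in> \<K>" for \<C>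
    using that unfolding \<K>_def by (intro sets.countable_Union) auto
  have "\<exists>\<C>\<in>\<K>. measure M (\<Union>\<C>) > s - 1 / real (Suc n)" for n
    using less_cSUP_iff[of \<K> "\<lambda>\<C>. measure M (\<Union>\<C>)" "s - 1 / real (Suc n)"] ne bdd unfolding s_def by auto
  then obtain C where C: "\<And>n. C n \<in> \<K>" "\<And>n. measure M (\<Union>(C n)) > s - 1 / real (Suc n)" by metis
  define D where "D = (\<Union>n. C n)"
  have D: "D \<in> \<K>" unfolding D_def \<K>_def using C(1) by (auto simp: \<K>_def)
  have "s \<le> measure M (\<Union>D)"
  proof (rule field_le_epsilon)
    fix d :: real assume "d > 0"
    then obtain n where "1 / real (Suc n) < d" using nat_approx_posE by auto
    moreover have "measure M (\<Union>(C n)) \<le> measure M (\<Union>D)"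
      by (intro finite_measure_mono m D) (auto simp: D_def)
    ultimately show "s \<le> measure M (\<Union>D) + d" using C(2)[of n] by linarith
  qed
  have "measure M (space M - \<Union>D) = 0"
  proof (rule ccontr)
    assume "measure M (space M - \<Union>D) \<noteq> 0"
    then have "measure M (space M - \<Union>D) > 0" by (simp add: zero_less_measure_iff)
    then obtain B where B: "B \<in> sets M" "B \<subseteq> space M - \<Union>D" "0 < measure M B" "measure M B < e"
      using atomless_imp_small_subset[OF assms(1) _ _ assms(2)] m[OF D] by blast
    have I: "insert B D \<in> \<K>" using D B unfolding \<K>_def by auto
    have "measure M (\<Union>(insert B D)) = measure M (B \<union> \<Union>D)" by simp
    also have "\<dots> = measure M B + measure M (\<Union>D)"
      using B m[OF D] by (intro finite_measure_Union) auto
    finally have "measure M (\<Union>(insert B D)) > s" using B \<open>s \<le> _\<close> by linarith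
    moreover have "measure M (\<Union>(insert B D)) \<le> s"
      unfolding s_def by (intro cSUP_upper I bdd)
    ultimately show False by simp
  qed
  then show ?thesis using D unfolding \<K>_def by blast
qed

subsection \<open>Uniform random variables on atomless spaces\<close>

text \<open>Covers by ever smaller sets are coded jointly. Points with equal code lie in the same
  members of every cover, so for every \<open>n\<close> a level set is contained in one set of
  measure below \<open>1 / (n + 1)\<close> or in the null set missed by the cover.\<close>

lemma (in prob_space) atomless_imp_diffuse_variable:
  assumes "atomless M"
  shows "\<exists>\<psi>\<in>borel_measurable M. range \<psi> \<subseteq> {0..1::real} \<and> (\<forall>t. measure M {x \<in> space M. \<psi> x = t} = 0)"
proof -
  define Q where "Q n \<C> \<longleftrightarrow> countable \<C> \<and> \<C> \<subseteq> {B \<in> sets M. measure M B < 1 / real (Suc n)} \<and>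
      measure M (space M - \<Union>\<C>) = 0" for n \<C>
  have "\<exists>\<C>. Q n \<C>" for n
    unfolding Q_def by (intro atomless_imp_small_cover assms) simp
  then obtain C where Q: "\<And>n. Q n (C n)" by metis
  have C: "countable (C n)" "C n \<subseteq> {B \<in> sets M. measure M B < 1 / real (Suc n)}"
    "measure M (space M - \<Union>(C n)) = 0" for n
    using Q[of n] unfolding Q_def by simp_all
  \<comment> \<open>The empty set makes \<open>D\<close> non-empty, as its enumeration by
    \<open>from_nat_into\<close> demands.\<close>
  define D where "D = insert {} (\<Union>n. C n)"
  define L where "L = from_nat_into D"
  have rL: "range L = D" unfolding L_def D_def using C by (intro range_from_nat_into) auto
  have L[measurable]: "L i \<in> sets M" for i
  proof -
    have "L i \<in> D" using rL by blast
    then show ?thesis unfolding D_def using C(2) by auto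
  qed
  note [measurable] = borel_measurable_ternary_code[of L, OF L]
  have "measure M {x \<in> space M. ternary_code L x = t} = 0" (is "measure M ?T = 0") for t
  proof -
    have "measure M ?T \<le> 1 / real (Suc n)" for n
    proof (cases "\<exists>B\<in>C n. \<exists>x\<in>?T. x \<in> B")
      case True
      then obtain B x where B: "B \<in> C n" "x \<in> ?T" "x \<in> B" by blast
      have "B \<in> range L" unfolding rL D_def using B(1) by auto
      then obtain i where i: "L i = B" by auto
      have "?T \<subseteq> B"
      proof
        fix y assume "y \<in> ?T"
        then show "y \<in> B" using ternary_code_eq_digit[of L x y i] B(2,3) i by simp
      qed
      then have "measure M ?T \<le> measure M B"
        using L[of i] unfolding i by (rule finite_measure_mono)
      also have "\<dots> < 1 / real (Suc n)" using B(1) C(2)[of n] by auto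
      finally show ?thesis by simp
    next
      case False
      then have "?T \<subseteq> space M - \<Union>(C n)" by auto
      moreover have "\<Union>(C n) \<in> sets M" using C by (intro sets.countable_Union) auto
      ultimately have "measure M ?T \<le> measure M (space M - \<Union>(C n))"
        by (intro finite_measure_mono) auto
      moreover have "0 \<le> 1 / real (Suc n)" by simp
      ultimately show ?thesis unfolding C(3) by linarith
    qed
    then have "measure M ?T \<le> 0"
      using LIMSEQ_le_const[OF LIMSEQ_Suc[OF lim_1_over_n], of "measure M ?T"] by blast
    then show ?thesis by (simp add: measure_le_0_iff)
  qed
  moreover have "range (ternary_code L) \<subseteq> {0..1}"
  proof -
    have "ternary_code L x \<le> 1" for x using ternary_code_le[of L x] by simp
    then show ?thesis using ternary_code_nonneg[of L] by auto
  qed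
  ultimately show ?thesis
    by (intro bexI[of _ "ternary_code L"]) auto
qed

lemma (in prob_space) refine_to_diffuse:
  fixes g \<psi> :: "'a \<Rightarrow> real"
  assumes [measurable]: "g \<in> borel_measurable M" "\<psi> \<in> borel_measurable M"
    and \<psi>: "range \<psi> \<subseteq> {0..1}" "\<And>t. measure M {x \<in> space M. \<psi> x = t} = 0"
  shows "\<exists>h\<in>borel_measurable M. (\<forall>x\<in>space M. \<forall>y\<in>space M. g x < g y \<longrightarrow> h x < (h y::real)) \<and>
    (\<forall>t. measure M {x \<in> space M. h x = t} = 0)"
proof -
  define lo where "lo c = measure M {z \<in> space M. g z < c}" for c
  define up where "up c = measure M {z \<in> space M. g z \<le> c}" for c
  have "mono lo" "mono up"
    unfolding lo_def up_def by (auto intro!: monoI finite_measure_mono)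
  note [measurable] = borel_measurable_mono[OF this(1)] borel_measurable_mono[OF this(2)]
  have lo_up: "lo c \<le> up c" for c unfolding lo_def up_def by (intro finite_measure_mono) auto
  have up_lo: "up c \<le> lo c'" if "c < c'" for c c'
    unfolding lo_def up_def using that by (intro finite_measure_mono) auto
  have atom: "up c - lo c = measure M {z \<in> space M. g z = c}" for c
    unfolding lo_def up_def
    by (subst finite_measure_Diff[symmetric]) (auto intro!: arg_cong[where f="measure M"])
  txt \<open>\<open>h\<close> orders points lexicographically by \<open>(g, \<psi>)\<close>: the jump of the distribution function of \<open>g\<close> at
    an atom leaves room for \<open>\<psi>\<close>.\<close>
  define h where "h x = g x + lo (g x) + (up (g x) - lo (g x)) * \<psi> x" for x
  have hm[measurable]: "h \<in> borel_measurable M" unfolding h_def[abs_def] by measurable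
  \<comment> \<open>Since \<open>up (g x)\<close> and \<open>lo (g y)\<close> may coincide where the
    distribution function of \<open>g\<close> is flat, the strict inequality comes from the summand
    \<open>g\<close> in \<open>h\<close>.\<close>
  have mono: "h x < h y" if "g x < g y" for x y
  proof -
    have "\<psi> x \<le> 1" "0 \<le> \<psi> y" using \<psi>(1) by (auto simp: image_subset_iff)
    then have "(up (g x) - lo (g x)) * \<psi> x \<le> (up (g x) - lo (g x)) * 1"
      "0 \<le> (up (g y) - lo (g y)) * \<psi> y"
      using lo_up by (auto intro!: mult_left_mono mult_nonneg_nonneg simp del: mult_1_right)
    then show ?thesis unfolding h_def using up_lo[OF that] that by simp
  qed
  have "measure M {x \<in> space M. h x = t} = 0" (is "measure M ?T = 0") for t
  proof (cases "?T = {}")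
    case False
    then obtain x where x: "x \<in> ?T" by auto
    have gx: "g y = g x" if "y \<in> ?T" for y
      using mono[of x y] mono[of y x] x that by (cases "g x" "g y" rule: linorder_cases) auto
    show ?thesis
    proof (cases "up (g x) - lo (g x) = 0")
      case True
      have "measure M ?T \<le> measure M {z \<in> space M. g z = g x}"
        using gx by (intro finite_measure_mono) auto
      then show ?thesis using True atom by (simp add: measure_le_0_iff)
    next
      case False
      have "\<psi> y = \<psi> x" if "y \<in> ?T" for y
        using x that False gx[OF that] unfolding h_def by auto
      then have "measure M ?T \<le> measure M {z \<in> space M. \<psi> z = \<psi> x}"
        by (intro finite_measure_mono) auto
      then show ?thesis using \<psi>(2) by (simp add: measure_le_0_iff)
    qed
  qed (simp only: measure_empty)
  with mono hm show ?thesis by (intro bexI[of _ h]) auto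
qed

text \<open>This is the probability integral transform. Diffuseness makes the distribution function
  \<open>F\<close> continuous, so for 0 < s < 1 its sublevel set is a half-line ending at a point
  \<open>u\<close> with \<open>F u = s\<close>.\<close>

lemma (in prob_space) distribution_transform_uniform:
  fixes h :: "'a \<Rightarrow> real"
  assumes [measurable]: "h \<in> borel_measurable M"
    and null: "\<And>t. measure M {x \<in> space M. h x = t} = 0"
    and t: "0 \<le> t" "t \<le> 1"
  shows "measure M {x \<in> space M. measure M {z \<in> space M. h z \<le> h x} \<le> t} = t"
proof -
  interpret D: real_distribution "distr M borel h" by simp
  define F where "F = cdf (distr M borel h)"
  have F: "F c = measure M {z \<in> space M. h z \<le> c}" for c
    unfolding F_def cdf_def by (subst measure_distr) (auto intro!: arg_cong[where f="measure M"])
  have cont: "isCont F c" for c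
    unfolding F_def D.isCont_cdf using null[of c]
    by (subst measure_distr) (auto simp: vimage_def Int_def conj_commute)
  have mono: "F a \<le> F b" if "a \<le> b" for a b
    unfolding F_def using D.cdf_nondecreasing that by blast
  have Fm[measurable]: "F \<in> borel_measurable borel"
    by (intro borel_measurable_mono monoI mono)
  have inner: "measure M {x \<in> space M. F (h x) \<le> s} = s" if s: "0 < s" "s < 1" for s
  proof -
    obtain a where a: "F a < s"
      using order_tendstoD(2)[OF D.cdf_lim_at_bot s(1)] unfolding F_def[symmetric]
      by (auto simp: eventually_at_bot_linorder)
    obtain b where b: "s < F b"
      using order_tendstoD(1)[OF D.cdf_lim_at_top_prob s(2)] unfolding F_def[symmetric]
      by (auto simp: eventually_at_top_linorder)
    define u where "u = Sup {c. F c \<le> s}"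
    have bdd: "bdd_above {c. F c \<le> s}"
      using b mono by (intro bdd_aboveI[of _ b]) (metis linorder_le_cases mem_Collect_eq not_less order.trans)
    have gt: "s < F c" if "u < c" for c
      using that cSup_upper[OF _ bdd, of c] unfolding u_def by (force simp: not_le[symmetric])
    have "F u = s"
    proof (rule antisym)
      show "s \<le> F u"
      proof (rule tendsto_lowerbound)
        show "(F \<longlongrightarrow> F u) (at_right u)" using cont[of u] by (simp add: continuous_within isCont_def filterlim_at_split)
        show "\<forall>\<^sub>F c in at_right u. s \<le> F c"
          using gt by (auto simp: eventually_at_right_field intro!: exI[of _ "u + 1"] less_imp_le)
      qed simp
      have "closed {c. F c \<le> s}"
        using cont by (intro closed_Collect_le continuous_intros) (auto simp: continuous_on_eq_continuous_at)
      then have "u \<in> {c. F c \<le> s}"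
        unfolding u_def using a by (intro closed_contains_Sup bdd) (auto intro: less_imp_le)
      then show "F u \<le> s" by simp
    qed
    have "F c \<le> s \<longleftrightarrow> c \<le> u" for c
      using gt[of c] mono[of c u] \<open>F u = s\<close> by force
    then show ?thesis using F[of u] \<open>F u = s\<close> by simp
  qed
  \<comment> \<open>For s = 0 the sublevel set of \<open>F\<close> may be empty and for s = 1 it is
    unbounded, so the end points are reached by monotonicity from inside the interval.\<close>
  define G where "G s = measure M {x \<in> space M. F (h x) \<le> s}" for s
  have Gmono: "G a \<le> G b" if "a \<le> b" for a b
    unfolding G_def using that by (intro finite_measure_mono) auto
  have "G t = t"
  proof (rule antisym)
    show "G t \<le> t"
    proof (cases "t = 1")
      case False
      show ?thesis
      proof (rule dense_ge_bounded[of t 1])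
        fix s assume "t < s" "s < 1"
        then show "G t \<le> s" using inner[of s] Gmono[of t s] t unfolding G_def by simp
      qed (use False t in simp)
    qed (simp add: G_def)
    show "t \<le> G t"
    proof (cases "t = 0")
      case False
      show ?thesis
      proof (rule dense_le_bounded[of 0 t])
        fix s assume "0 < s" "s < t"
        then show "s \<le> G t" using inner[of s] Gmono[of s t] t unfolding G_def by simp
      qed (use False t in simp)
    qed (simp add: G_def)
  qed
  then show ?thesis unfolding G_def F .
qed

lemma prob_space_unit_interval: "prob_space unit_interval"
  by (auto simp: emeasure_restrict_space space_restrict_space intro!: prob_spaceI)

lemma space_unit_interval [simp]: "space unit_interval = {0..1}"
  by (simp add: space_restrict_space)

text \<open>A probability measure on the line is determined by its distribution function; the images
  of both spaces are therefore compared on all of \<open>borel\<close>.\<close>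

lemma (in prob_space) measure_preserving_unit_intervalI:
  fixes f :: "'a \<Rightarrow> real"
  assumes [measurable]: "f \<in> borel_measurable M"
    and range: "\<And>x. x \<in> space M \<Longrightarrow> f x \<in> {0..1}"
    and cdf: "\<And>t. 0 \<le> t \<Longrightarrow> t \<le> 1 \<Longrightarrow> measure M {x \<in> space M. f x \<le> t} = t"
  shows "measure_preserving M unit_interval f"
proof -
  interpret U: prob_space unit_interval by (rule prob_space_unit_interval)
  have idm[measurable]: "(\<lambda>x. x) \<in> borel_measurable unit_interval"
    by (intro measurable_restrict_space1) simp
  have fm[measurable]: "f \<in> measurable M unit_interval"
    using range by (intro measurable_restrict_space2) auto
  have "cdf (distr M borel f) c = cdf (distr unit_interval borel (\<lambda>x. x)) c" for c
  proof -
    have 1: "cdf (distr M borel f) c = measure M {x \<in> space M. f x \<le> c}"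
      unfolding cdf_def by (subst measure_distr) (auto intro!: arg_cong[where f="measure M"])
    have 2: "cdf (distr unit_interval borel (\<lambda>x. x)) c = measure lborel ({..c} \<inter> {0..1})"
      unfolding cdf_def by (subst measure_distr) (auto simp: measure_restrict_space)
    consider "c < 0" | "0 \<le> c" "c \<le> 1" | "1 < c" by linarith
    then show ?thesis
    proof cases
      case 1
      then have "{..c} \<inter> {0..1} = {}" "{x \<in> space M. f x \<le> c} = {}" using range by force+
      then show ?thesis
        unfolding \<open>cdf (distr M borel f) c = _\<close> 2 by (simp only: measure_empty)
    next
      case 2
      then have "{..c} \<inter> {0..1} = {0..c}" by auto
      then show ?thesis unfolding 1 \<open>cdf (distr unit_interval borel _) c = _\<close> using cdf 2 by simp
    next
      case 3
      then have "{..c} \<inter> {0..1} = {0..1}" "{x \<in> space M. f x \<le> c} = space M" using range by force+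
      then show ?thesis unfolding 1 2 by (simp add: prob_space)
    qed
  qed
  then have eq: "distr M borel f = distr unit_interval borel (\<lambda>x. x)"
    by (intro cdf_unique U.real_distribution_distr real_distribution_distr ext) auto
  show ?thesis
    unfolding measure_preserving_def
  proof (intro conjI ballI)
    fix A assume "A \<in> sets unit_interval"
    then have A: "A \<in> sets borel" "A \<subseteq> {0..1}"
      by (auto simp: sets_restrict_space)
    then have "emeasure M (f -` A \<inter> space M) = emeasure (distr M borel f) A"
      by (simp add: emeasure_distr)
    also have "\<dots> = emeasure unit_interval A"
      unfolding eq using A by (subst emeasure_distr) (auto simp: Int_absorb2)
    finally show "emeasure M (f -` A \<inter> space M) = emeasure unit_interval A" .
  qed fact
qed

subsection \<open>Lower sets of an ordered probability space\<close>

locale uniform_variable = prob_space M for M :: "'a measure" +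
  fixes f :: "'a \<Rightarrow> real"
  assumes measurable_f [measurable]: "f \<in> borel_measurable M"
    and range_f: "\<And>x. x \<in> space M \<Longrightarrow> f x \<in> {0..1}"
    and cdf_f: "\<And>t. 0 \<le> t \<Longrightarrow> t \<le> 1 \<Longrightarrow> measure M {x \<in> space M. f x \<le> t} = t"
begin

lemma measure_f_Ioc:
  assumes "0 \<le> a" "a \<le> b" "b \<le> 1"
  shows "measure M {x \<in> space M. a < f x \<and> f x \<le> b} = b - a"
proof -
  have "{x \<in> space M. a < f x \<and> f x \<le> b} = {x \<in> space M. f x \<le> b} - {x \<in> space M. f x \<le> a}"
    by auto
  then show ?thesis using assms by (simp add: finite_measure_Diff cdf_f subset_eq)
qed

lemma measure_f_eq: "measure M {x \<in> space M. f x = t} = 0"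
proof -
  have "measure M {x \<in> space M. f x = t} \<le> 0 + e" if "e > 0" for e
  proof (cases "t \<in> {0..1}")
    case True
    show ?thesis
    proof (cases "t < e")
      case True
      have "measure M {x \<in> space M. f x = t} \<le> measure M {x \<in> space M. f x \<le> t}"
        by (intro finite_measure_mono) auto
      then show ?thesis using True \<open>t \<in> {0..1}\<close> cdf_f[of t] by simp
    next
      case False
      have "measure M {x \<in> space M. f x = t} \<le> measure M {x \<in> space M. t - e < f x \<and> f x \<le> t}"
        using that by (intro finite_measure_mono) auto
      then show ?thesis using False that \<open>t \<in> {0..1}\<close> measure_f_Ioc[of "t - e" t] by simp
    qed
  next
    case False
    then have "{x \<in> space M. f x = t} = {}" using range_f by auto
    then show ?thesis using that by (simp only: measure_empty)
  qed
  then have "measure M {x \<in> space M. f x = t} \<le> 0" by (rule field_le_epsilon)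
  then show ?thesis by (simp add: measure_le_0_iff)
qed

lemma AE_f_neq: "AE x in M. f x \<noteq> t"
proof -
  have "{x \<in> space M. f x = t} \<in> null_sets M"
    by (simp add: null_sets_def emeasure_eq_measure measure_f_eq)
  from AE_not_in[OF this] AE_space show ?thesis by eventually_elim simp
qed

end

section \<open>The depth function of the order\<close>

context ordered_prob_space
begin

lemma measurable_lt [measurable]: "(\<lambda>(x, y). lt x y) \<in> measurable (M \<Otimes>\<^sub>M M) (count_space UNIV)"
proof -
  have "{p \<in> space (M \<Otimes>\<^sub>M M). case p of (x, y) \<Rightarrow> lt x y} = {(x, y). x \<in> space M \<and> y \<in> space M \<and> lt x y}"
    by (auto simp: space_pair_measure)
  then show ?thesis using sets_lt by (simp only: pred_def)
qed

definition lower_set :: "'a set \<Rightarrow> bool" where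
  "lower_set L \<longleftrightarrow> L \<in> sets M \<and> (\<forall>x\<in>space M. \<forall>y\<in>L. lt x y \<longrightarrow> x \<in> L)"

definition depth :: "'a \<Rightarrow> real" where
  "depth y = measure M {x \<in> space M. lt x y}"

lemma borel_measurable_depth [measurable]: "depth \<in> borel_measurable M"
  unfolding depth_def[abs_def] by measurable

lemma lt_trans: "x \<in> space M \<Longrightarrow> y \<in> space M \<Longrightarrow> z \<in> space M \<Longrightarrow> lt x y \<Longrightarrow> lt y z \<Longrightarrow> lt x z"
  using transp_lt unfolding transp_on_def by blast

lemma lt_irrefl: "x \<in> space M \<Longrightarrow> \<not> lt x x"
  using irreflp_lt unfolding irreflp_on_def by blast

lemma depth_mono:
  assumes "x \<in> space M" "y \<in> space M" "lt x y"
  shows "depth x \<le> depth y"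
proof -
  have "{z \<in> space M. lt z x} \<subseteq> {z \<in> space M. lt z y}"
    using assms by (blast intro: lt_trans)
  then show ?thesis
    unfolding depth_def using assms by (intro finite_measure_mono) measurable
qed

lemma lower_set_depth: "lower_set {y \<in> space M. depth y < q}"
  unfolding lower_set_def
proof (intro conjI ballI impI)
  fix x y assume "x \<in> space M" "y \<in> {y \<in> space M. depth y < q}" "lt x y"
  then show "x \<in> {y \<in> space M. depth y < q}" using depth_mono[of x y] by simp
qed measurable

lemma AE_depth_less: 
  assumes y: "y \<in> space M"
  shows "AE x in M. lt x y \<longrightarrow> depth x < depth y"
proof -
  interpret P: pair_prob_space M M ..
  txt \<open>For \<open>x \<in> B\<close> the sets below \<open>x\<close> and below \<open>y\<close> agree up to a null set, hence almost all of \<open>B\<close> lies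
    below \<open>x\<close>. By Fubini almost all pairs in \<open>B \<times> B\<close> are related in both directions.\<close>
  define B where "B = {x \<in> space M. lt x y \<and> depth x = depth y}"
  have B[measurable]: "B \<in> sets M" unfolding B_def using y by measurable
  have "AE z in M. x \<in> B \<and> z \<in> B \<longrightarrow> lt z x" if x: "x \<in> space M" for x
  proof (cases "x \<in> B")
    case True
    have m: "{z \<in> space M. lt z y} \<in> sets M" "{z \<in> space M. lt z x} \<in> sets M"
      using x y by measurable
    have "{z \<in> space M. lt z x} \<subseteq> {z \<in> space M. lt z y}"
      using x y True unfolding B_def by (blast intro: lt_trans)
    then have "measure M ({z \<in> space M. lt z y} - {z \<in> space M. lt z x}) = depth y - depth x"
      unfolding depth_def using m by (intro finite_measure_Diff)
    also have "\<dots> = 0" using True by (simp add: B_def)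
    finally have "AE z in M. z \<notin> {z \<in> space M. lt z y} - {z \<in> space M. lt z x}"
      using m by (intro AE_not_in) (simp add: null_sets_def emeasure_eq_measure sets.Diff)
    then show ?thesis by eventually_elim (simp add: B_def)
  qed simp
  then have 1: "AE x in M. AE z in M. x \<in> B \<and> z \<in> B \<longrightarrow> lt z x" by (rule AE_I2)
  then have 2: "AE z in M. AE x in M. x \<in> B \<and> z \<in> B \<longrightarrow> lt z x"
    by (subst P.AE_commute) measurable
  have "B \<in> null_sets M"
  proof (rule ccontr)
    assume "B \<notin> null_sets M"
    then have nn: "\<not> (AE z in M. z \<notin> B)" using AE_iff_null_sets[OF B] by simp
    from 1 2 have "AE x in M. x \<notin> B"
    proof eventually_elim
      case (elim x)
      show ?case
      proof
        assume x: "x \<in> B"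
        from elim have "AE z in M. z \<notin> B"
        proof eventually_elim
          case (elim z)
          show ?case
          proof
            assume z: "z \<in> B"
            have "lt x z" "lt z x" "x \<in> space M" "z \<in> space M"
              using elim x z by (simp_all add: B_def)
            then show False using lt_trans[of x z x] lt_irrefl[of x] by blast
          qed
        qed
        with nn show False by blast
      qed
    qed
    with nn show False by blast
  qed
  then have "AE x in M. x \<notin> B" by (rule AE_not_in)
  then show ?thesis
    using AE_space
  proof eventually_elim
    case (elim x)
    then show ?case using depth_mono[of x y] y unfolding B_def by simp linarith
  qed
qed

end

section \<open>Level sets of the sections of a strict kernel\<close>

context strict_poset_kernel
begin

text \<open>Strictness gives \<open>W x' x > 0\<close>, and \<open>W x y > q\<close> is positive;
  the kernel axiom then yields \<open>W x' y = 1\<close>, which is above every level that is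
  attained at all.\<close>

lemma lower_set_superlevel:
  assumes y: "y \<in> space M" and q: "0 \<le> q"
  shows "lower_set {x \<in> space M. q < W x y}"
  unfolding lower_set_def
proof (intro conjI ballI impI)
  note [measurable] = kernel_measurable
  show "{x \<in> space M. q < W x y} \<in> sets M" using y by measurable
  fix x' x assume x': "x' \<in> space M" and "x \<in> {x \<in> space M. q < W x y}" and lt: "lt x' x"
  then have x: "x \<in> space M" "q < W x y" by auto
  have "W x' y = 1"
    using kernel_trans[OF x' x(1) y kernel_strict[OF x' x(1) lt]] x q by simp
  moreover have "W x y \<le> 1" using kernel_range[OF x(1) y] by simp
  ultimately show "x' \<in> {x \<in> space M. q < W x y}" using x x' by simp
qed

text \<open>In the second argument the kernel grows along the order. If \<open>W x y' > q\<close>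
  for some \<open>y'\<close> below \<open>y\<close>, then \<open>W x y = 1\<close>, and
  \<open>W x y \<le> q\<close> would force \<open>W x y' > 1\<close>.\<close>

lemma lower_set_sublevel:
  assumes x: "x \<in> space M" and q: "0 \<le> q"
  shows "lower_set {y \<in> space M. W x y \<le> q}"
  unfolding lower_set_def
proof (intro conjI ballI impI)
  note [measurable] = kernel_measurable
  show "{y \<in> space M. W x y \<le> q} \<in> sets M" using x by measurable
  fix y' y assume y': "y' \<in> space M" and "y \<in> {y \<in> space M. W x y \<le> q}" and lt: "lt y' y"
  then have y: "y \<in> space M" "W x y \<le> q" by auto
  have "W x y' \<le> q"
  proof (rule ccontr)
    assume n: "\<not> W x y' \<le> q"
    then have "W x y = 1"
      using kernel_trans[OF x y' y(1) _ kernel_strict[OF y' y(1) lt]] q by simp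
    then show False using n y(2) kernel_range[OF x y'] by simp
  qed
  then show "y' \<in> {y \<in> space M. W x y \<le> q}" using y' by simp
qed

text \<open>The dense families are taken among the level sets themselves, at rational levels and
  countably many base points; approximating sets of another origin need not be lower sets.\<close>

lemma dense_sequence_of_lower_sets:
  obtains L :: "nat \<Rightarrow> 'a set"
  where "\<And>i. lower_set (L i)"
    and "\<And>q. q \<in> \<rat> \<Longrightarrow> \<exists>i. L i = {y \<in> space M. depth y < q}"
    and "\<And>q y e. q \<in> \<rat> \<Longrightarrow> 0 \<le> q \<Longrightarrow> y \<in> space M \<Longrightarrow> 0 < e \<Longrightarrow>
      \<exists>i. measure M (sym_diff {x \<in> space M. q < W x y} (L i)) < e"
    and "\<And>q x e. q \<in> \<rat> \<Longrightarrow> 0 \<le> q \<Longrightarrow> x \<in> space M \<Longrightarrow> 0 < e \<Longrightarrow>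
      \<exists>i. measure M (sym_diff {y \<in> space M. W x y \<le> q} (L i)) < e"
proof -
  note [measurable] = kernel_measurable
  define S where "S q y = {x \<in> space M. q < W x y}" for q y
  define T where "T q x = {y \<in> space M. W x y \<le> q}" for q x
  define dense where "dense R Y \<longleftrightarrow> countable Y \<and> Y \<subseteq> space M \<and>
    (\<forall>y\<in>space M. \<forall>e>0. \<exists>y'\<in>Y. measure M (sym_diff (R y) (R y')) < e)" for R :: "'a \<Rightarrow> 'a set" and Y
  have "\<exists>Y. dense (S q) Y" for q
  proof -
    define A where "A = {p \<in> space (M \<Otimes>\<^sub>M M). case p of (x, y) \<Rightarrow> q < W x y}"
    have A: "A \<in> sets (M \<Otimes>\<^sub>M M)" unfolding A_def by measurable
    have eq: "(\<lambda>x. (x, y)) -` A = S q y" if "y \<in> space M" for y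
      unfolding A_def S_def using that by (auto simp: space_pair_measure)
    obtain Y where Y: "countable Y" "Y \<subseteq> space M"
      "\<And>y e. y \<in> space M \<Longrightarrow> 0 < e \<Longrightarrow> \<exists>y'\<in>Y. measure M (sym_diff ((\<lambda>x. (x, y)) -` A) ((\<lambda>x. (x, y')) -` A)) < e"
      using sections_separable[OF A] by blast
    have "\<exists>y'\<in>Y. measure M (sym_diff (S q y) (S q y')) < e" if "y \<in> space M" "0 < e" for y e
      using Y(3)[OF that] Y(2) that(1) by (metis eq subsetD)
    then show ?thesis unfolding dense_def using Y by blast
  qed
  then obtain Y where Y: "\<And>q. dense (S q) (Y q)" by metis
  have "\<exists>Y. dense (T q) Y" for q
  proof -
    \<comment> \<open>The coordinates are swapped because \<open>sections_separable\<close> fixes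
      the second one.\<close>
    define A where "A = {p \<in> space (M \<Otimes>\<^sub>M M). case p of (y, x) \<Rightarrow> W x y \<le> q}"
    have A: "A \<in> sets (M \<Otimes>\<^sub>M M)" unfolding A_def by measurable
    have eq: "(\<lambda>y. (y, x)) -` A = T q x" if "x \<in> space M" for x
      unfolding A_def T_def using that by (auto simp: space_pair_measure)
    obtain Y where Y: "countable Y" "Y \<subseteq> space M"
      "\<And>y e. y \<in> space M \<Longrightarrow> 0 < e \<Longrightarrow> \<exists>y'\<in>Y. measure M (sym_diff ((\<lambda>x. (x, y)) -` A) ((\<lambda>x. (x, y')) -` A)) < e"
      using sections_separable[OF A] by blast
    have "\<exists>y'\<in>Y. measure M (sym_diff (T q y) (T q y')) < e" if "y \<in> space M" "0 < e" for y e
      using Y(3)[OF that] Y(2) that(1) by (metis eq subsetD)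
    then show ?thesis unfolding dense_def using Y by blast
  qed
  then obtain Z where Z: "\<And>q. dense (T q) (Z q)" by metis
  define \<L> where "\<L> = (\<lambda>q. {y \<in> space M. depth y < q}) ` \<rat> \<union>
    (\<Union>q\<in>\<rat> \<inter> {0..}. S q ` Y q) \<union> (\<Union>q\<in>\<rat> \<inter> {0..}. T q ` Z q)"
  have "countable \<L>"
    unfolding \<L>_def using Y Z
    by (intro countable_Un countable_UN countable_image countable_Int1 countable_rat) (simp_all add: dense_def)
  moreover have "\<L> \<noteq> {}" unfolding \<L>_def using Rats_0 by blast
  ultimately have rL: "range (from_nat_into \<L>) = \<L>" by (intro range_from_nat_into)
  have ex: "\<exists>i. from_nat_into \<L> i = X" if "X \<in> \<L>" for X
    using that rL by (metis rangeE)
  have "lower_set X" if "X \<in> \<L>" for X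
    using that unfolding \<L>_def
  proof (elim UnE UN_E imageE)
    fix q y assume "q \<in> \<rat> \<inter> {0..}" "X = S q y" "y \<in> Y q"
    then show ?thesis using Y[of q] unfolding S_def dense_def by (auto intro!: lower_set_superlevel)
  next
    fix q x assume "q \<in> \<rat> \<inter> {0..}" "X = T q x" "x \<in> Z q"
    then show ?thesis using Z[of q] unfolding T_def dense_def by (auto intro!: lower_set_sublevel)
  qed (simp add: lower_set_depth)
  then have lower: "lower_set (from_nat_into \<L> i)" for i
    using rL by (metis rangeI)
  have depth: "\<exists>i. from_nat_into \<L> i = {y \<in> space M. depth y < q}" if "q \<in> \<rat>" for q
    using that by (intro ex) (simp add: \<L>_def)
  have S_dense: "\<exists>i. measure M (sym_diff (S q y) (from_nat_into \<L> i)) < e"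
    if q: "q \<in> \<rat>" "0 \<le> q" and y: "y \<in> space M" "0 < e" for q y e
  proof -
    obtain y' where y': "y' \<in> Y q" "measure M (sym_diff (S q y) (S q y')) < e"
      using Y[of q] y unfolding dense_def by blast
    have "S q y' \<in> \<L>" unfolding \<L>_def using q y' by auto
    from ex[OF this] y'(2) show ?thesis by metis
  qed
  have T_dense: "\<exists>i. measure M (sym_diff (T q y) (from_nat_into \<L> i)) < e"
    if q: "q \<in> \<rat>" "0 \<le> q" and y: "y \<in> space M" "0 < e" for q y e
  proof -
    obtain y' where y': "y' \<in> Z q" "measure M (sym_diff (T q y) (T q y')) < e"
      using Z[of q] y unfolding dense_def by blast
    have "T q y' \<in> \<L>" unfolding \<L>_def using q y' by auto
    from ex[OF this] y'(2) show ?thesis by metis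
  qed
  show thesis
    using lower depth S_dense T_dense unfolding S_def T_def by (rule that)
qed

end

text \<open>The last conclusion makes every sublevel set of the code a threshold set of
  \<open>f\<close> up to the null set \<open>{f = p}\<close>. It is stated by two inclusions because
  the distribution function of \<open>h\<close> may be flat, so that \<open>f\<close> can identify
  points with different codes.\<close>

lemma (in ordered_prob_space) uniform_monotone_variable:
  assumes "atomless M"
    and L: "\<And>i. lower_set (L i)" "\<And>q. q \<in> \<rat> \<Longrightarrow> \<exists>i::nat. L i = {y \<in> space M. depth y < q}"
  obtains f where "uniform_variable M f" "AE (x, y) in M \<Otimes>\<^sub>M M. lt x y \<longrightarrow> f x < f y"
    "\<And>u. \<exists>p. \<forall>x\<in>space M. (f x < p \<longrightarrow> ternary_code L x < u) \<and> (ternary_code L x < u \<longrightarrow> f x \<le> p)"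
proof -
  interpret P: pair_prob_space M M ..
  define g where "g = ternary_code L"
  have L_sets: "L i \<in> sets M" for i using L(1) by (simp add: lower_set_def)
  then have [measurable]: "g \<in> borel_measurable M" unfolding g_def by (rule borel_measurable_ternary_code)
  obtain \<psi> where \<psi>: "\<psi> \<in> borel_measurable M" "range \<psi> \<subseteq> {0..1::real}"
    "\<And>t. measure M {x \<in> space M. \<psi> x = t} = 0"
    using atomless_imp_diffuse_variable[OF assms(1)] by blast
  obtain h :: "'a \<Rightarrow> real" where h[measurable]: "h \<in> borel_measurable M"
    and gh: "\<And>x y. x \<in> space M \<Longrightarrow> y \<in> space M \<Longrightarrow> g x < g y \<Longrightarrow> h x < h y"
    and null: "\<And>t. measure M {x \<in> space M. h x = t} = 0"
    using refine_to_diffuse[OF _ \<psi>, of g] by auto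
  define F where "F c = measure M {z \<in> space M. h z \<le> c}" for c
  have Fmono: "F a \<le> F b" if "a \<le> b" for a b
    unfolding F_def using that by (intro finite_measure_mono) auto
  have [measurable]: "F \<in> borel_measurable borel" by (intro borel_measurable_mono monoI Fmono)
  define f where "f x = F (h x)" for x
  have fm[measurable]: "f \<in> borel_measurable M" unfolding f_def[abs_def] by measurable
  have U: "uniform_variable M f"
  proof
    show "measure M {x \<in> space M. f x \<le> t} = t" if "0 \<le> t" "t \<le> 1" for t
      unfolding f_def F_def using distribution_transform_uniform[OF h null that] .
  qed (auto simp: f_def F_def)
  then interpret U: uniform_variable M f .
  have g_mono: "g x \<le> g y" if "x \<in> space M" "lt x y" for x y
    unfolding g_def using L(1) that by (intro ternary_code_mono) (auto simp: lower_set_def)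
  \<comment> \<open>A rational between the two depths is the level of some \<open>L i\<close>, whose
    digit separates the codes.\<close>
  have g_less: "g x < g y" if xy: "x \<in> space M" "y \<in> space M" "lt x y" "depth x < depth y" for x y
  proof -
    obtain q where q: "q \<in> \<rat>" "depth x < q" "q < depth y"
      using Rats_dense_in_real[OF xy(4)] by blast
    obtain i where i: "L i = {y \<in> space M. depth y < q}" using L(2)[OF q(1)] by blast
    have "x \<in> L i" "y \<notin> L i" unfolding i using q xy by auto
    then have "g x \<noteq> g y" unfolding g_def using ternary_code_eq_digit[of L x y i] by blast
    then show ?thesis using g_mono[OF xy(1,3)] by simp
  qed
  have "AE y in M. AE x in M. lt x y \<longrightarrow> f x < f y"
  proof (rule AE_I2)
    fix y assume y: "y \<in> space M"
    \<comment> \<open>From \<open>h x < h y\<close> only \<open>f x \<le> f y\<close> follows;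
      equality with the fixed value \<open>f y\<close> is an event of probability zero.\<close>
    show "AE x in M. lt x y \<longrightarrow> f x < f y"
      using AE_depth_less[OF y] U.AE_f_neq[of "f y"] AE_space
    proof eventually_elim
      case (elim x)
      show ?case
      proof
        assume lt: "lt x y"
        then have "h x < h y" using gh g_less elim y by simp
        then show "f x < f y" using Fmono[of "h x" "h y"] elim(2) unfolding f_def by simp
      qed
    qed
  qed
  then have "AE x in M. AE y in M. lt x y \<longrightarrow> f x < f y"
    by (subst P.AE_commute) measurable
  then have mono: "AE p in M \<Otimes>\<^sub>M M. case p of (x, y) \<Rightarrow> lt x y \<longrightarrow> f x < f y"
  proof (intro P.AE_pair_measure)
    show "{p \<in> space (M \<Otimes>\<^sub>M M). case p of (x, y) \<Rightarrow> lt x y \<longrightarrow> f x < f y} \<in> sets (M \<Otimes>\<^sub>M M)"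
      by measurable
  qed simp
  \<comment> \<open>The witness is the mass of \<open>{g < u}\<close>. As \<open>h\<close> refines
    \<open>g\<close>, the set \<open>{h \<le> h x}\<close> is contained in \<open>{g < u}\<close> if
    \<open>g x < u\<close>, and contains it otherwise.\<close>
  have "\<exists>p. \<forall>x\<in>space M. (f x < p \<longrightarrow> g x < u) \<and> (g x < u \<longrightarrow> f x \<le> p)" for u
  proof (intro exI[of _ "measure M {x \<in> space M. g x < u}"] ballI conjI impI)
    fix x assume x: "x \<in> space M"
    show "f x \<le> measure M {x \<in> space M. g x < u}" if "g x < u"
      unfolding f_def F_def
    proof (intro finite_measure_mono subsetI CollectI conjI)
      fix z assume "z \<in> {z \<in> space M. h z \<le> h x}"
      then show "z \<in> space M" "g z < u" using gh[of x z] x that by force+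
    qed measurable
    show "g x < u" if "f x < measure M {x \<in> space M. g x < u}"
    proof (rule ccontr)
      assume n: "\<not> g x < u"
      have "measure M {x \<in> space M. g x < u} \<le> f x"
        unfolding f_def F_def
      proof (intro finite_measure_mono subsetI CollectI conjI)
        fix z assume "z \<in> {x \<in> space M. g x < u}"
        then show "z \<in> space M" "h z \<le> h x" using gh[of z x] x n by force+
      qed measurable
      with that show False by simp
    qed
  qed
  with U mono show thesis unfolding g_def by (rule that)
qed

subsection \<open>Averaging over the cells of a uniform variable\<close>

text \<open>As a function of \<open>t\<close> this is the uniform density on the cell of length
  \<open>1 / (n + 1)\<close> that contains \<open>s\<close>; integrating against it averages over
  that cell.\<close>

definition cell_kernel :: "nat \<Rightarrow> real \<Rightarrow> real \<Rightarrow> real" where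
  "cell_kernel n s t = real (Suc n) * of_bool (\<lfloor>real (Suc n) * s\<rfloor> = \<lfloor>real (Suc n) * t\<rfloor>)"

lemma cell_kernel_nonneg: "0 \<le> cell_kernel n s t"
  by (simp add: cell_kernel_def)

lemma cell_kernel_commute: "cell_kernel n s t = cell_kernel n t s"
  by (simp add: cell_kernel_def eq_commute)

lemma borel_measurable_cell_kernel [measurable]:
  assumes [measurable]: "u \<in> borel_measurable N" "v \<in> borel_measurable N"
  shows "(\<lambda>x. cell_kernel n (u x) (v x)) \<in> borel_measurable N"
  unfolding cell_kernel_def by measurable

lemma ennreal_tendsto_0_le:
  fixes u v :: "nat \<Rightarrow> ennreal"
  assumes "\<And>n. u n \<le> v n" "v \<longlonglongrightarrow> 0"
  shows "u \<longlonglongrightarrow> 0"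
  by (rule tendsto_sandwich[of "\<lambda>_. 0" u sequentially v 0])
    (simp_all add: assms always_eventually)

section \<open>Cells of a uniform variable and oscillation inside them\<close>

context uniform_variable
begin

lemma measure_f_Ico:
  assumes "0 \<le> a" "a \<le> b" "b \<le> 1"
  shows "measure M {x \<in> space M. a \<le> f x \<and> f x < b} = b - a"
proof -
  have "measure M {x \<in> space M. a \<le> f x \<and> f x < b} = measure M {x \<in> space M. a < f x \<and> f x \<le> b}"
    using AE_f_neq[of a] AE_f_neq[of b]
    by (intro finite_measure_eq_AE) (auto elim!: eventually_elim2)
  then show ?thesis using measure_f_Ioc[OF assms] by simp
qed

lemma cell_eq: "{x \<in> space M. \<lfloor>real (Suc n) * f x\<rfloor> = j} =
    {x \<in> space M. real_of_int j / real (Suc n) \<le> f x \<and> f x < (real_of_int j + 1) / real (Suc n)}"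
  by (auto simp: floor_eq_iff field_simps)

lemma measure_cell:
  assumes "0 \<le> j" "j \<le> int n"
  shows "measure M {x \<in> space M. \<lfloor>real (Suc n) * f x\<rfloor> = j} = 1 / real (Suc n)"
proof -
  have "(real_of_int j + 1) / real (Suc n) \<le> 1" using assms by (simp add: field_simps)
  then show ?thesis
    unfolding cell_eq using assms
    by (subst measure_f_Ico) (simp_all add: divide_right_mono diff_divide_distrib[symmetric])
qed

text \<open>Outside the regular range of indices only \<open>n + 1\<close> can occur, and only where
  \<open>f\<close> takes the value 1, which has probability zero.\<close>

lemma measure_cell_le: "measure M {x \<in> space M. \<lfloor>real (Suc n) * f x\<rfloor> = j} \<le> 1 / real (Suc n)"
proof (cases "0 \<le> j \<and> j \<le> int n")
  case True
  then show ?thesis using measure_cell[of j n] by (simp del: of_nat_Suc)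
next
  case False
  have "x \<in> {x \<in> space M. f x = 1}" if "x \<in> space M" "\<lfloor>real (Suc n) * f x\<rfloor> = j" for x
  proof -
    have f: "0 \<le> f x" "f x \<le> 1" using range_f[OF that(1)] by auto
    then have "0 \<le> j" unfolding that(2)[symmetric] by simp
    then have "int n < j" using False by simp
    then have "int (Suc n) \<le> j" by simp
    then have "real (Suc n) \<le> real (Suc n) * f x" unfolding that(2)[symmetric] le_floor_iff by simp
    then have "1 \<le> f x" by (simp add: mult_le_cancel_left1)
    then show ?thesis using f that by simp
  qed
  then have "{x \<in> space M. \<lfloor>real (Suc n) * f x\<rfloor> = j} \<subseteq> {x \<in> space M. f x = 1}" by blast
  then have "measure M {x \<in> space M. \<lfloor>real (Suc n) * f x\<rfloor> = j} \<le> measure M {x \<in> space M. f x = 1}"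
    by (intro finite_measure_mono) measurable
  also have "\<dots> \<le> 1 / real (Suc n)" unfolding measure_f_eq by simp
  finally show ?thesis .
qed

lemma nn_integral_cell_kernel:
  "(\<integral>\<^sup>+x. ennreal (cell_kernel n s (f x)) \<partial>M) =
    ennreal (real (Suc n) * measure M {x \<in> space M. \<lfloor>real (Suc n) * f x\<rfloor> = \<lfloor>real (Suc n) * s\<rfloor>})"
proof -
  have "(\<integral>\<^sup>+x. ennreal (cell_kernel n s (f x)) \<partial>M) =
      (\<integral>\<^sup>+x. ennreal (real (Suc n)) * indicator {x \<in> space M. \<lfloor>real (Suc n) * f x\<rfloor> = \<lfloor>real (Suc n) * s\<rfloor>} x \<partial>M)"
    by (intro nn_integral_cong) (auto simp: cell_kernel_def indicator_def)
  also have "\<dots> = ennreal (real (Suc n)) * emeasure M {x \<in> space M. \<lfloor>real (Suc n) * f x\<rfloor> = \<lfloor>real (Suc n) * s\<rfloor>}"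
    by (rule nn_integral_cmult_indicator) measurable
  finally show ?thesis by (simp only: emeasure_eq_measure ennreal_mult' of_nat_0_le_iff)
qed

lemma nn_integral_cell_kernel_le: "(\<integral>\<^sup>+x. ennreal (cell_kernel n s (f x)) \<partial>M) \<le> 1"
proof -
  have "real (Suc n) * measure M {x \<in> space M. \<lfloor>real (Suc n) * f x\<rfloor> = \<lfloor>real (Suc n) * s\<rfloor>}
      \<le> real (Suc n) * (1 / real (Suc n))"
    by (intro mult_left_mono measure_cell_le) simp
  then show ?thesis unfolding nn_integral_cell_kernel by (simp del: of_nat_Suc)
qed

lemma nn_integral_cell_kernel_eq:
  assumes "0 \<le> s" "s < 1"
  shows "(\<integral>\<^sup>+x. ennreal (cell_kernel n s (f x)) \<partial>M) = 1"
proof -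
  have "real (Suc n) * s < real (Suc n)" using assms by simp
  then have "\<lfloor>real (Suc n) * s\<rfloor> < int (Suc n)" unfolding floor_less_iff by simp
  moreover have "0 \<le> \<lfloor>real (Suc n) * s\<rfloor>" using assms by simp
  ultimately show ?thesis
    unfolding nn_integral_cell_kernel by (subst measure_cell) (simp_all del: of_nat_Suc)
qed

text \<open>The mean of \<open>\<bar>g x - g x'\<bar>\<close> over pairs of points in a common cell.
  That it tends to 0 expresses, without conditional expectations, that \<open>g\<close> is a
  function of \<open>f\<close> up to null sets.\<close>

definition oscillation :: "nat \<Rightarrow> ('a \<Rightarrow> real) \<Rightarrow> ennreal" where
  "oscillation n g = (\<integral>\<^sup>+x. \<integral>\<^sup>+x'. ennreal (\<bar>g x - g x'\<bar> * cell_kernel n (f x) (f x')) \<partial>M \<partial>M)"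

lemma oscillation_mono:
  assumes "\<And>x x'. x \<in> space M \<Longrightarrow> x' \<in> space M \<Longrightarrow> \<bar>g x - g x'\<bar> \<le> \<bar>h x - h x'\<bar>"
  shows "oscillation n g \<le> oscillation n h"
  unfolding oscillation_def using assms
  by (intro nn_integral_mono ennreal_leI mult_right_mono cell_kernel_nonneg)

lemma oscillation_add:
  assumes [measurable]: "h1 \<in> borel_measurable M" "h2 \<in> borel_measurable M"
    and le: "\<And>x x'. x \<in> space M \<Longrightarrow> x' \<in> space M \<Longrightarrow> \<bar>g x - g x'\<bar> \<le> \<bar>h1 x - h1 x'\<bar> + \<bar>h2 x - h2 x'\<bar>"
  shows "oscillation n g \<le> oscillation n h1 + oscillation n h2"
proof -
  have "oscillation n g \<le> (\<integral>\<^sup>+x. \<integral>\<^sup>+x'. ennreal (\<bar>h1 x - h1 x'\<bar> * cell_kernel n (f x) (f x')) +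
      ennreal (\<bar>h2 x - h2 x'\<bar> * cell_kernel n (f x) (f x')) \<partial>M \<partial>M)"
    unfolding oscillation_def
  proof (intro nn_integral_mono)
    fix x x' assume "x \<in> space M" "x' \<in> space M"
    then have "\<bar>g x - g x'\<bar> * cell_kernel n (f x) (f x')
        \<le> (\<bar>h1 x - h1 x'\<bar> + \<bar>h2 x - h2 x'\<bar>) * cell_kernel n (f x) (f x')"
      by (intro mult_right_mono le cell_kernel_nonneg)
    then show "ennreal (\<bar>g x - g x'\<bar> * cell_kernel n (f x) (f x')) \<le>
        ennreal (\<bar>h1 x - h1 x'\<bar> * cell_kernel n (f x) (f x')) + ennreal (\<bar>h2 x - h2 x'\<bar> * cell_kernel n (f x) (f x'))"
      by (subst ennreal_plus[symmetric]) (simp_all add: cell_kernel_nonneg distrib_right ennreal_leI del: ennreal_plus)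
  qed
  also have "\<dots> = oscillation n h1 + oscillation n h2"
    unfolding oscillation_def by (simp add: nn_integral_add)
  finally show ?thesis .
qed

lemma nn_integral_kernel_fst_le:
  fixes u :: "'a \<Rightarrow> ennreal"
  assumes [measurable]: "u \<in> borel_measurable M"
  shows "(\<integral>\<^sup>+x. \<integral>\<^sup>+x'. u x * ennreal (cell_kernel n (f x) (f x')) \<partial>M \<partial>M) \<le> (\<integral>\<^sup>+x. u x \<partial>M)"
proof (intro nn_integral_mono)
  fix x
  have "(\<integral>\<^sup>+x'. u x * ennreal (cell_kernel n (f x) (f x')) \<partial>M) = u x * (\<integral>\<^sup>+x'. ennreal (cell_kernel n (f x) (f x')) \<partial>M)"
    by (intro nn_integral_cmult) measurable
  also have "\<dots> \<le> u x * 1" by (intro mult_left_mono nn_integral_cell_kernel_le) simp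
  finally show "(\<integral>\<^sup>+x'. u x * ennreal (cell_kernel n (f x) (f x')) \<partial>M) \<le> u x" by simp
qed

lemma nn_integral_kernel_snd_le:
  fixes u :: "'a \<Rightarrow> ennreal"
  assumes [measurable]: "u \<in> borel_measurable M"
  shows "(\<integral>\<^sup>+x. \<integral>\<^sup>+x'. u x' * ennreal (cell_kernel n (f x) (f x')) \<partial>M \<partial>M) \<le> (\<integral>\<^sup>+x. u x \<partial>M)"
proof -
  interpret P: pair_prob_space M M ..
  have "(\<integral>\<^sup>+x. \<integral>\<^sup>+x'. u x' * ennreal (cell_kernel n (f x) (f x')) \<partial>M \<partial>M) =
      (\<integral>\<^sup>+x'. \<integral>\<^sup>+x. u x' * ennreal (cell_kernel n (f x) (f x')) \<partial>M \<partial>M)"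
    by (rule P.Fubini'[symmetric]) measurable
  also have "\<dots> = (\<integral>\<^sup>+x. \<integral>\<^sup>+x'. u x * ennreal (cell_kernel n (f x) (f x')) \<partial>M \<partial>M)"
    by (simp only: cell_kernel_commute)
  finally show ?thesis using nn_integral_kernel_fst_le[of u n] by simp
qed

lemma oscillation_le:
  assumes "\<And>x x'. x \<in> space M \<Longrightarrow> x' \<in> space M \<Longrightarrow> \<bar>g x - g x'\<bar> \<le> 1"
  shows "oscillation n g \<le> 1"
proof -
  have "oscillation n g \<le> (\<integral>\<^sup>+x. \<integral>\<^sup>+x'. 1 * ennreal (cell_kernel n (f x) (f x')) \<partial>M \<partial>M)"
    unfolding oscillation_def using assms
    by (intro nn_integral_mono) (auto intro!: ennreal_leI mult_left_le_one_le simp: cell_kernel_nonneg)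
  also have "\<dots> \<le> (\<integral>\<^sup>+x. 1 \<partial>M)" by (rule nn_integral_kernel_fst_le) simp
  finally show ?thesis by (simp add: emeasure_space_1)
qed

text \<open>Both \<open>x\<close> and \<open>x'\<close> are perturbed, and the cell kernel has mass
  at most 1 in either variable; hence the factor 2.\<close>

lemma oscillation_perturb:
  assumes [measurable]: "g \<in> borel_measurable M" "h \<in> borel_measurable M"
  shows "oscillation n g \<le> oscillation n h + 2 * (\<integral>\<^sup>+x. ennreal \<bar>g x - h x\<bar> \<partial>M)"
proof -
  let ?d = "\<lambda>x. ennreal \<bar>g x - h x\<bar>"
  have "oscillation n g \<le> (\<integral>\<^sup>+x. \<integral>\<^sup>+x'. ennreal (\<bar>h x - h x'\<bar> * cell_kernel n (f x) (f x')) +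
      (?d x * ennreal (cell_kernel n (f x) (f x')) + ?d x' * ennreal (cell_kernel n (f x) (f x'))) \<partial>M \<partial>M)"
    unfolding oscillation_def
  proof (intro nn_integral_mono)
    fix x x'
    have "\<bar>g x - g x'\<bar> \<le> \<bar>h x - h x'\<bar> + (\<bar>g x - h x\<bar> + \<bar>g x' - h x'\<bar>)" by simp
    then have "\<bar>g x - g x'\<bar> * cell_kernel n (f x) (f x')
        \<le> (\<bar>h x - h x'\<bar> + (\<bar>g x - h x\<bar> + \<bar>g x' - h x'\<bar>)) * cell_kernel n (f x) (f x')"
      by (intro mult_right_mono cell_kernel_nonneg)
    then show "ennreal (\<bar>g x - g x'\<bar> * cell_kernel n (f x) (f x')) \<le>
        ennreal (\<bar>h x - h x'\<bar> * cell_kernel n (f x) (f x')) +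
        (?d x * ennreal (cell_kernel n (f x) (f x')) + ?d x' * ennreal (cell_kernel n (f x) (f x')))"
      by (simp add: ennreal_mult[symmetric] ennreal_plus[symmetric] cell_kernel_nonneg distrib_right ennreal_leI
        del: ennreal_plus)
  qed
  also have "\<dots> = oscillation n h + ((\<integral>\<^sup>+x. \<integral>\<^sup>+x'. ?d x * ennreal (cell_kernel n (f x) (f x')) \<partial>M \<partial>M) +
      (\<integral>\<^sup>+x. \<integral>\<^sup>+x'. ?d x' * ennreal (cell_kernel n (f x) (f x')) \<partial>M \<partial>M))"
    unfolding oscillation_def by (simp add: nn_integral_add)
  also have "\<dots> \<le> oscillation n h + ((\<integral>\<^sup>+x. ?d x \<partial>M) + (\<integral>\<^sup>+x. ?d x \<partial>M))"
    by (intro add_mono order_refl nn_integral_kernel_fst_le nn_integral_kernel_snd_le) measurable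
  finally show ?thesis by (simp only: mult_2)
qed

lemma oscillation_tendsto_0_closure:
  assumes g: "g \<in> borel_measurable M"
    and approx: "\<And>e. e > 0 \<Longrightarrow> \<exists>h\<in>borel_measurable M. (\<lambda>n. oscillation n h) \<longlonglongrightarrow> 0 \<and> (\<integral>\<^sup>+x. ennreal \<bar>g x - h x\<bar> \<partial>M) \<le> ennreal e"
  shows "(\<lambda>n. oscillation n g) \<longlonglongrightarrow> 0"
proof (rule tendsto_zero_ennreal)
  fix r :: real assume r: "0 < r"
  \<comment> \<open>One r/4 for the oscillation of \<open>h\<close> and twice r/4 for the
    perturbation leave a total of 3r/4, strictly below r.\<close>
  then obtain h where h: "h \<in> borel_measurable M" "(\<lambda>n. oscillation n h) \<longlonglongrightarrow> 0"
    "(\<integral>\<^sup>+x. ennreal \<bar>g x - h x\<bar> \<partial>M) \<le> ennreal (r / 4)"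
    using approx[of "r / 4"] by auto
  have "\<forall>\<^sub>F n in sequentially. oscillation n h < ennreal (r / 4)"
    using order_tendstoD(2)[OF h(2), of "ennreal (r / 4)"] r by simp
  then show "\<forall>\<^sub>F n in sequentially. oscillation n g < ennreal r"
  proof eventually_elim
    case (elim n)
    have "oscillation n g \<le> oscillation n h + 2 * (\<integral>\<^sup>+x. ennreal \<bar>g x - h x\<bar> \<partial>M)"
      by (rule oscillation_perturb[OF g h(1)])
    also have "\<dots> \<le> ennreal (r / 4) + 2 * ennreal (r / 4)"
      using elim h(3) by (intro add_mono mult_left_mono) auto
    also have "\<dots> = ennreal (r / 4) + (ennreal (r / 4) + ennreal (r / 4))" by (simp only: mult_2)
    also have "\<dots> = ennreal (3 * r / 4)"
      using r by (simp add: ennreal_plus[symmetric] del: ennreal_plus)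
    also have "\<dots> < ennreal r" using r by (simp add: ennreal_less_iff)
    finally show ?case .
  qed
qed

text \<open>A stand-in for the \<sigma>-algebra generated by \<open>f\<close> and the null sets,
  described by oscillation so that membership survives approximation in measure.\<close>

definition resolved_sets :: "'a set set" where
  "resolved_sets = {X \<in> sets M. (\<lambda>n. oscillation n (indicator X)) \<longlonglongrightarrow> 0}"

lemma nn_integral_indicator_diff:
  assumes [measurable]: "X \<in> sets M" "Y \<in> sets M"
  shows "(\<integral>\<^sup>+x. ennreal \<bar>indicat_real X x - indicator Y x\<bar> \<partial>M) = ennreal (measure M (sym_diff X Y))"
proof -
  have "(\<integral>\<^sup>+x. ennreal \<bar>indicat_real X x - indicator Y x\<bar> \<partial>M) = (\<integral>\<^sup>+x. indicator (sym_diff X Y) x \<partial>M)"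
    by (intro nn_integral_cong) (auto simp: indicator_def)
  then show ?thesis by (simp add: emeasure_eq_measure)
qed

lemma resolved_sets_closure:
  assumes X: "X \<in> sets M" and "\<And>e. e > 0 \<Longrightarrow> \<exists>Y\<in>resolved_sets. measure M (sym_diff X Y) < e"
  shows "X \<in> resolved_sets"
  unfolding resolved_sets_def
proof (intro CollectI conjI X oscillation_tendsto_0_closure)
  fix e :: real assume "0 < e"
  then obtain Y where Y: "Y \<in> resolved_sets" "measure M (sym_diff X Y) < e" using assms(2) by blast
  then have "Y \<in> sets M" "(\<lambda>n. oscillation n (indicator Y)) \<longlonglongrightarrow> 0" by (auto simp: resolved_sets_def)
  with Y(2) X show "\<exists>h\<in>borel_measurable M. (\<lambda>n. oscillation n h) \<longlonglongrightarrow> 0 \<and>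
      (\<integral>\<^sup>+x. ennreal \<bar>indicat_real X x - h x\<bar> \<partial>M) \<le> ennreal e"
    by (intro bexI[of _ "indicator Y"] conjI) (auto simp: nn_integral_indicator_diff intro!: ennreal_leI)
qed (use X in measurable)

lemma sets_resolved_sets: "X \<in> resolved_sets \<Longrightarrow> X \<in> sets M"
  by (simp add: resolved_sets_def)

lemma oscillation_zero: "oscillation n (\<lambda>_. c) = 0"
  by (simp add: oscillation_def)

lemma resolved_sets_Un:
  assumes "X \<in> resolved_sets" "Y \<in> resolved_sets"
  shows "X \<union> Y \<in> resolved_sets"
proof -
  have le: "oscillation n (indicator (X \<union> Y)) \<le> oscillation n (indicator X) + oscillation n (indicator Y)" for n
    using assms[THEN sets_resolved_sets]
    by (intro oscillation_add) (auto simp: indicator_def)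
  have "(\<lambda>n. oscillation n (indicator X) + oscillation n (indicator Y)) \<longlonglongrightarrow> 0 + 0"
    using assms by (intro tendsto_add) (auto simp: resolved_sets_def)
  then have "(\<lambda>n. oscillation n (indicator (X \<union> Y))) \<longlonglongrightarrow> 0"
    using ennreal_tendsto_0_le[OF le] by simp
  then show ?thesis using assms[THEN sets_resolved_sets] by (simp add: resolved_sets_def)
qed

text \<open>Subadditivity of the oscillation handles finite unions, and closure under approximation
  in measure extends this to countable ones. The gain is that measurability arguments apply to
  resolved sets.\<close>

lemma sigma_algebra_resolved_sets: "sigma_algebra (space M) resolved_sets"
  unfolding sigma_algebra_iff2
proof (intro conjI ballI allI impI)
  show "resolved_sets \<subseteq> Pow (space M)"
    using sets.sets_into_space by (auto simp: resolved_sets_def)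
  show empty: "{} \<in> resolved_sets"
    by (simp add: resolved_sets_def oscillation_def)
  show "space M - X \<in> resolved_sets" if "X \<in> resolved_sets" for X
  proof -
    have "oscillation n (indicator (space M - X)) \<le> oscillation n (indicator X)" for n
      by (intro oscillation_mono) (auto simp: indicator_def)
    moreover have "(\<lambda>n. oscillation n (indicator X)) \<longlonglongrightarrow> 0" using that by (simp add: resolved_sets_def)
    ultimately have "(\<lambda>n. oscillation n (indicator (space M - X))) \<longlonglongrightarrow> 0"
      by (rule ennreal_tendsto_0_le)
    then show ?thesis using that[THEN sets_resolved_sets] by (simp add: resolved_sets_def sets.compl_sets)
  qed
  fix A :: "nat \<Rightarrow> 'a set" assume "range A \<subseteq> resolved_sets"
  then have A: "A i \<in> resolved_sets" for i by auto
  have fin: "(\<Union>i<n. A i) \<in> resolved_sets" for n :: nat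
  proof (induction n)
    case (Suc n)
    have "(\<Union>i<Suc n. A i) = A n \<union> (\<Union>i<n. A i)" by (simp add: lessThan_Suc)
    then show ?case using resolved_sets_Un[OF A Suc] by simp
  qed (simp add: empty)
  have [measurable]: "A i \<in> sets M" for i by (intro sets_resolved_sets A)
  show "(\<Union>i. A i) \<in> resolved_sets"
  proof (rule resolved_sets_closure)
    fix e :: real assume e: "0 < e"
    have "(\<lambda>n. measure M (\<Union>i<n. A i)) \<longlonglongrightarrow> measure M (\<Union>n. \<Union>i<n. A i)"
      by (intro finite_Lim_measure_incseq monoI UN_mono) auto
    moreover have "(\<Union>n. \<Union>i<n. A i) = (\<Union>i. A i)" by auto
    ultimately have "\<exists>n. measure M (\<Union>i<n. A i) > measure M (\<Union>i. A i) - e"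
      using e by (intro eventually_happens'[OF sequentially_bot] order_tendstoD(1)) auto
    then obtain n where n: "measure M (\<Union>i. A i) - measure M (\<Union>i<n. A i) < e"
      by (metis diff_less_eq less_diff_eq add.commute)
    have "sym_diff (\<Union>i. A i) (\<Union>i<n. A i) = (\<Union>i. A i) - (\<Union>i<n. A i)" by auto
    then have "measure M (sym_diff (\<Union>i. A i) (\<Union>i<n. A i)) < e"
      using n by (simp, subst finite_measure_Diff) auto
    then show "\<exists>Y\<in>resolved_sets. measure M (sym_diff (\<Union>i. A i) Y) < e"
      using fin by blast
  qed measurable
qed

text \<open>Only pairs within one cell that straddle \<open>p\<close> contribute, and that cell must
  be the cell of \<open>p\<close>.\<close>

lemma oscillation_threshold: "oscillation n (indicator {x \<in> space M. f x < p}) \<le> ennreal (1 / real (Suc n))"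
proof -
  define C where "C = {x \<in> space M. \<lfloor>real (Suc n) * f x\<rfloor> = \<lfloor>real (Suc n) * p\<rfloor>}"
  have [measurable]: "C \<in> sets M" unfolding C_def by measurable
  have cell: "x \<in> C"
    if "x \<in> space M" "\<lfloor>real (Suc n) * f x\<rfloor> = \<lfloor>real (Suc n) * f x'\<rfloor>" "(f x < p) \<noteq> (f x' < p)" for x x'
  proof -
    have mono: "\<lfloor>real (Suc n) * a\<rfloor> \<le> \<lfloor>real (Suc n) * b\<rfloor>" if "a \<le> b" for a b
      using that by (intro floor_mono mult_left_mono) auto
    have "\<lfloor>real (Suc n) * f x\<rfloor> = \<lfloor>real (Suc n) * p\<rfloor>"
    proof (cases "f x < p")
      case True
      then have "f x \<le> p" "p \<le> f x'" using that(3) by auto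
      from this[THEN mono] that(2) show ?thesis by linarith
    next
      case False
      then have "f x' \<le> p" "p \<le> f x" using that(3) by auto
      from this[THEN mono] that(2) show ?thesis by linarith
    qed
    then show ?thesis unfolding C_def using that(1) by blast
  qed
  have "oscillation n (indicator {x \<in> space M. f x < p}) \<le>
      (\<integral>\<^sup>+x. \<integral>\<^sup>+x'. indicator C x * ennreal (cell_kernel n (f x) (f x')) \<partial>M \<partial>M)"
    unfolding oscillation_def
  proof (intro nn_integral_mono)
    fix x x' assume "x \<in> space M" "x' \<in> space M"
    then show "ennreal (\<bar>indicat_real {x \<in> space M. f x < p} x - indicator {x \<in> space M. f x < p} x'\<bar> *
        cell_kernel n (f x) (f x')) \<le> indicator C x * ennreal (cell_kernel n (f x) (f x'))"
      using cell[of x x']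
      by (cases "\<lfloor>real (Suc n) * f x\<rfloor> = \<lfloor>real (Suc n) * f x'\<rfloor>"; cases "f x < p"; cases "f x' < p")
        (simp_all add: cell_kernel_def)
  qed
  also have "\<dots> \<le> (\<integral>\<^sup>+x. indicator C x \<partial>M)" by (rule nn_integral_kernel_fst_le) measurable
  also have "\<dots> = ennreal (measure M C)" by (simp add: emeasure_eq_measure)
  also have "\<dots> \<le> ennreal (1 / real (Suc n))" unfolding C_def by (intro ennreal_leI measure_cell_le)
  finally show ?thesis .
qed

lemma resolved_sets_sandwich:
  assumes X: "X \<in> sets M"
    and p: "\<And>x. x \<in> space M \<Longrightarrow> f x < p \<Longrightarrow> x \<in> X" "\<And>x. x \<in> X \<Longrightarrow> f x \<le> p"
  shows "X \<in> resolved_sets"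
proof (rule resolved_sets_closure[OF X])
  fix e :: real assume "0 < e"
  have "(\<lambda>n. ennreal (1 / real (Suc n))) \<longlonglongrightarrow> ennreal 0"
    by (intro tendsto_ennrealI LIMSEQ_Suc lim_1_over_n)
  then have "(\<lambda>n. oscillation n (indicator {x \<in> space M. f x < p})) \<longlonglongrightarrow> 0"
    unfolding ennreal_0 by (rule ennreal_tendsto_0_le[OF oscillation_threshold])
  then have "{x \<in> space M. f x < p} \<in> resolved_sets" by (simp add: resolved_sets_def)
  moreover have "measure M (sym_diff X {x \<in> space M. f x < p}) \<le> measure M {x \<in> space M. f x = p}"
    using p sets.sets_into_space[OF X] by (intro finite_measure_mono) force+
  ultimately show "\<exists>Y\<in>resolved_sets. measure M (sym_diff X Y) < e"
    using \<open>0 < e\<close> measure_f_eq[of p] by (intro bexI[of _ "{x \<in> space M. f x < p}"]) auto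
qed

text \<open>The resolved sets serve as the \<sigma>-algebra of an auxiliary space \<open>N\<close>.
  The code is measurable there because its sublevel sets are thresholds of \<open>f\<close> up to
  null sets; reading off its digits in \<open>N\<close> then puts every \<open>L i\<close> among the
  resolved sets.\<close>

lemma resolved_sets_ternary_code:
  assumes L: "\<And>i. L i \<in> sets M"
    and p: "\<And>u. \<exists>p. \<forall>x\<in>space M. (f x < p \<longrightarrow> ternary_code L x < u) \<and> (ternary_code L x < u \<longrightarrow> f x \<le> p)"
  shows "L i \<in> resolved_sets"
proof -
  note [measurable] = borel_measurable_ternary_code[of L, OF L]
  define N where "N = sigma (space M) resolved_sets"
  have N: "space N = space M" "sets N = resolved_sets"
    unfolding N_def
    by (simp_all add: space_measure_of_conv sigma_algebra.sets_measure_of_eq[OF sigma_algebra_resolved_sets])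
  have "ternary_code L \<in> borel_measurable N"
    unfolding borel_measurable_iff_less N
  proof
    fix u
    obtain p where "\<forall>x\<in>space M. (f x < p \<longrightarrow> ternary_code L x < u) \<and> (ternary_code L x < u \<longrightarrow> f x \<le> p)"
      using p[of u] by blast
    then show "{w \<in> space M. ternary_code L w < u} \<in> resolved_sets"
      by (intro resolved_sets_sandwich[of _ p]) auto
  qed
  from sets_ternary_code_digit[OF this, of i] show ?thesis
    using sets.sets_into_space[OF L[of i]] by (simp add: N Int_absorb2)
qed

lemma oscillation_cmult:
  assumes [measurable]: "h \<in> borel_measurable M" and c: "0 \<le> c"
  shows "oscillation n (\<lambda>x. c * h x) = ennreal c * oscillation n h"
proof -
  define F where "F x x' = ennreal (\<bar>h x - h x'\<bar> * cell_kernel n (f x) (f x'))" for x x'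
  have [measurable]: "(\<lambda>(x, x'). F x x') \<in> borel_measurable (M \<Otimes>\<^sub>M M)" unfolding F_def by measurable
  have "ennreal (\<bar>c * h x - c * h x'\<bar> * cell_kernel n (f x) (f x')) = ennreal c * F x x'" for x x'
    unfolding F_def ennreal_mult'[OF c, symmetric] right_diff_distrib[symmetric] abs_mult abs_of_nonneg[OF c]
    by (simp only: mult.assoc)
  then have "oscillation n (\<lambda>x. c * h x) = (\<integral>\<^sup>+x. \<integral>\<^sup>+x'. ennreal c * F x x' \<partial>M \<partial>M)"
    unfolding oscillation_def by (simp only:)
  also have "\<dots> = ennreal c * (\<integral>\<^sup>+x. \<integral>\<^sup>+x'. F x x' \<partial>M \<partial>M)"
  proof -
    have "(\<integral>\<^sup>+x. \<integral>\<^sup>+x'. ennreal c * F x x' \<partial>M \<partial>M) = (\<integral>\<^sup>+x. ennreal c * (\<integral>\<^sup>+x'. F x x' \<partial>M) \<partial>M)"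
      by (intro nn_integral_cong nn_integral_cmult) measurable
    also have "\<dots> = ennreal c * (\<integral>\<^sup>+x. \<integral>\<^sup>+x'. F x x' \<partial>M \<partial>M)"
      by (rule nn_integral_cmult) measurable
    finally show ?thesis .
  qed
  finally show ?thesis unfolding oscillation_def F_def .
qed

lemma oscillation_sum_tendsto_0:
  assumes "finite I" "\<And>i. i \<in> I \<Longrightarrow> X i \<in> resolved_sets"
  shows "(\<lambda>n. oscillation n (\<lambda>x. \<Sum>i\<in>I. indicat_real (X i) x)) \<longlonglongrightarrow> 0"
  using assms
proof (induction I rule: finite_induct)
  case empty
  then show ?case by (simp add: oscillation_zero)
next
  case (insert i I)
  have m: "X j \<in> sets M" if "j \<in> insert i I" for j using insert.prems[OF that] by (rule sets_resolved_sets)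
  then have [measurable]: "indicat_real (X i) \<in> borel_measurable M" "(\<lambda>x. \<Sum>i\<in>I. indicat_real (X i) x) \<in> borel_measurable M"
    by (auto intro!: borel_measurable_sum borel_measurable_indicator)
  have "oscillation n (\<lambda>x. \<Sum>i\<in>insert i I. indicat_real (X i) x) \<le>
      oscillation n (indicator (X i)) + oscillation n (\<lambda>x. \<Sum>i\<in>I. indicat_real (X i) x)" for n
    using insert.hyps by (intro oscillation_add) auto
  moreover have "(\<lambda>n. oscillation n (indicator (X i)) + oscillation n (\<lambda>x. \<Sum>i\<in>I. indicat_real (X i) x)) \<longlonglongrightarrow> 0 + 0"
    using insert by (intro tendsto_add) (auto simp: resolved_sets_def)
  ultimately show ?case
    unfolding add_0 by (rule ennreal_tendsto_0_le)
qed

lemma oscillation_tendsto_0_superlevel: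
  assumes g[measurable]: "g \<in> borel_measurable M"
    and range: "\<And>x. x \<in> space M \<Longrightarrow> g x \<in> {0..1}"
    and level: "\<And>q. q \<in> \<rat> \<Longrightarrow> 0 \<le> q \<Longrightarrow> {x \<in> space M. q < g x} \<in> resolved_sets"
  shows "(\<lambda>n. oscillation n g) \<longlonglongrightarrow> 0"
proof (rule oscillation_tendsto_0_closure[OF g])
  fix e :: real assume "e > 0"
  then obtain m where m: "1 / real (Suc m) < e" using nat_approx_posE by blast
  define N where "N = Suc m"
  define X where "X i = {x \<in> space M. real i / real N < g x}" for i
  have X: "X i \<in> resolved_sets" for i
    unfolding X_def by (intro level) auto
  \<comment> \<open>\<open>s x\<close> counts the levels \<open>i / N\<close> strictly below
    \<open>g x\<close>. This number is N times \<open>g x\<close> rounded up, so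
    \<open>s / N\<close> is uniformly within \<open>1 / N\<close> of \<open>g\<close>. All levels
    are rational, which is why \<open>level\<close> is required only there.\<close>
  define s where "s x = (\<Sum>i<N. indicat_real (X i) x)" for x
  have sm[measurable]: "s \<in> borel_measurable M"
    unfolding s_def[abs_def] using X[THEN sets_resolved_sets]
    by (auto intro!: borel_measurable_sum borel_measurable_indicator)
  have N: "0 < real N" by (simp add: N_def)
  have close: "\<bar>g x - 1 / real N * s x\<bar> \<le> e" if x: "x \<in> space M" for x
  proof -
    have "{i. i < N \<and> x \<in> X i} = {..<nat \<lceil>real N * g x\<rceil>}"
    proof (intro set_eqI)
      fix i
      have "real N * g x \<le> real N" using range[OF x] N by (simp add: mult_left_le)
      have "i < nat \<lceil>real N * g x\<rceil> \<longleftrightarrow> real i < real N * g x"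
        by (simp add: zless_nat_eq_int_zless less_ceiling_iff)
      moreover have "x \<in> X i \<longleftrightarrow> real i < real N * g x"
        using x N unfolding X_def by (simp add: field_simps)
      moreover have "i < N" if "real i < real N * g x"
        using that \<open>real N * g x \<le> real N\<close> by simp
      ultimately show "i \<in> {i. i < N \<and> x \<in> X i} \<longleftrightarrow> i \<in> {..<nat \<lceil>real N * g x\<rceil>}" by auto
    qed
    moreover have "s x = real (card {i. i < N \<and> x \<in> X i})"
    proof -
      have "s x = (\<Sum>i<N. if x \<in> X i then 1 else 0)" unfolding s_def by (intro sum.cong) (auto simp: indicator_def)
      also have "\<dots> = real (card ({..<N} \<inter> {i. x \<in> X i}))" by (subst sum.If_cases) auto
      also have "{..<N} \<inter> {i. x \<in> X i} = {i. i < N \<and> x \<in> X i}" by auto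
      finally show ?thesis .
    qed
    ultimately have "s x = real (nat \<lceil>real N * g x\<rceil>)" by simp
    also have "\<dots> = real_of_int \<lceil>real N * g x\<rceil>"
      using range[OF x] by (simp add: mult_nonneg_nonneg)
    finally have s: "s x = real_of_int \<lceil>real N * g x\<rceil>" .
    have "real N * g x \<le> s x" "s x < real N * g x + 1" unfolding s by linarith+
    then have "g x \<le> 1 / real N * s x" "1 / real N * s x < g x + 1 / real N"
      using N by (simp_all add: field_simps)
    then show ?thesis using m unfolding N_def by linarith
  qed
  have "(\<lambda>n. oscillation n (\<lambda>x. 1 / real N * s x)) \<longlonglongrightarrow> 0"
  proof -
    have "(\<lambda>n. ennreal (1 / real N) * oscillation n s) \<longlonglongrightarrow> ennreal (1 / real N) * 0"
      unfolding s_def[abs_def] using X by (intro ennreal_tendsto_cmult oscillation_sum_tendsto_0) auto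
    then show ?thesis by (subst oscillation_cmult) auto
  qed
  moreover have "(\<integral>\<^sup>+x. ennreal \<bar>g x - 1 / real N * s x\<bar> \<partial>M) \<le> (\<integral>\<^sup>+x. ennreal e \<partial>M)"
    by (intro nn_integral_mono ennreal_leI close)
  ultimately show "\<exists>h\<in>borel_measurable M. (\<lambda>n. oscillation n h) \<longlonglongrightarrow> 0 \<and>
      (\<integral>\<^sup>+x. ennreal \<bar>g x - h x\<bar> \<partial>M) \<le> ennreal e"
    by (intro bexI[of _ "\<lambda>x. 1 / real N * s x"]) (auto simp: emeasure_space_1)
qed

end

text \<open>The indices are chosen with the k-th integral below \<open>(1/2) ^ k\<close>. The series
  of the chosen functions then has finite integral, so it converges almost everywhere and its terms
  tend to 0. \<open>r\<close> is not claimed to increase: all later limits run over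
  \<open>k\<close>.\<close>

lemma nn_integral_tendsto_0_AE_subseq:
  fixes u :: "nat \<Rightarrow> 'b \<Rightarrow> ennreal"
  assumes [measurable]: "\<And>n. u n \<in> borel_measurable N"
    and lim: "(\<lambda>n. \<integral>\<^sup>+z. u n z \<partial>N) \<longlonglongrightarrow> 0"
  shows "\<exists>r :: nat \<Rightarrow> nat. AE z in N. (\<lambda>k. u (r k) z) \<longlonglongrightarrow> 0"
proof -
  have "\<exists>n. (\<integral>\<^sup>+z. u n z \<partial>N) < ennreal ((1/2) ^ k)" for k
    using order_tendstoD(2)[OF lim, of "ennreal ((1/2) ^ k)"]
    by (intro eventually_happens'[OF sequentially_bot]) simp
  then obtain r where r: "\<And>k. (\<integral>\<^sup>+z. u (r k) z \<partial>N) < ennreal ((1/2) ^ k)" by metis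
  have "(\<integral>\<^sup>+z. (\<Sum>k. u (r k) z) \<partial>N) = (\<Sum>k. \<integral>\<^sup>+z. u (r k) z \<partial>N)"
    by (rule nn_integral_suminf) measurable
  also have "\<dots> \<le> (\<Sum>k. ennreal ((1/2) ^ k))"
    by (intro suminf_le less_imp_le r summableI)
  also have "\<dots> = ennreal (\<Sum>k. (1/2) ^ k)"
    by (intro suminf_ennreal2 summable_geometric) auto
  finally have "(\<integral>\<^sup>+z. (\<Sum>k. u (r k) z) \<partial>N) \<noteq> \<infinity>"
    by (metis ennreal_less_top infinity_ennreal_def leD)
  then have "AE z in N. (\<Sum>k. u (r k) z) \<noteq> \<infinity>"
    by (intro nn_integral_noteq_infinite) measurable
  then have "AE z in N. (\<lambda>k. u (r k) z) \<longlonglongrightarrow> 0"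
  proof eventually_elim
    case (elim z)
    have fin: "u (r k) z \<noteq> top" for k
    proof
      assume "u (r k) z = top"
      moreover have "u (r k) z \<le> (\<Sum>k. u (r k) z)"
        using sum_le_suminf[of "\<lambda>k. u (r k) z" "{k}"] by (simp add: summableI)
      ultimately show False using elim by (simp add: top_unique)
    qed
    define v where "v k = enn2real (u (r k) z)" for k
    have v: "u (r k) z = ennreal (v k)" for k
      unfolding v_def using fin[of k] by (simp add: less_top)
    have "summable v"
      using elim unfolding v by (intro summable_suminf_not_top) (simp_all add: v_def)
    then have "(\<lambda>k. ennreal (v k)) \<longlonglongrightarrow> ennreal 0"
      by (intro tendsto_ennrealI summable_LIMSEQ_zero)
    then show ?case unfolding v by simp
  qed
  then show ?thesis by blast
qed

section \<open>Functions of two variables on pairs of cells\<close>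

context uniform_variable
begin

text \<open>Unlike \<open>oscillation\<close>, this is not integrated over the base point, since
  cell averages have to converge at almost every individual point.\<close>

definition oscillation2 :: "nat \<Rightarrow> ('a \<Rightarrow> 'a \<Rightarrow> real) \<Rightarrow> 'a \<Rightarrow> 'a \<Rightarrow> ennreal" where
  "oscillation2 n V x y = (\<integral>\<^sup>+x'. \<integral>\<^sup>+y'. ennreal \<bar>V x y - V x' y'\<bar> *
    (ennreal (cell_kernel n (f x) (f x')) * ennreal (cell_kernel n (f y) (f y'))) \<partial>M \<partial>M)"

text \<open>The cell of \<open>s = 1\<close> is a null set, so \<open>cell_mean n V 1 t = 0\<close>; hence the restriction to \<open>{0..<1}\<close> below.\<close>

definition cell_mean :: "nat \<Rightarrow> ('a \<Rightarrow> 'a \<Rightarrow> real) \<Rightarrow> real \<Rightarrow> real \<Rightarrow> ennreal" where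
  "cell_mean n V s t = (\<integral>\<^sup>+x. \<integral>\<^sup>+y. ennreal (V x y) *
    (ennreal (cell_kernel n s (f x)) * ennreal (cell_kernel n t (f y))) \<partial>M \<partial>M)"

lemma borel_measurable_oscillation2:
  assumes [measurable]: "(\<lambda>(x, y). V x y) \<in> borel_measurable (M \<Otimes>\<^sub>M M)"
  shows "(\<lambda>(x, y). oscillation2 n V x y) \<in> borel_measurable (M \<Otimes>\<^sub>M M)"
  unfolding oscillation2_def by measurable

lemma borel_measurable_cell_mean:
  assumes [measurable]: "(\<lambda>(x, y). V x y) \<in> borel_measurable (M \<Otimes>\<^sub>M M)"
    "u \<in> borel_measurable N" "v \<in> borel_measurable N"
  shows "(\<lambda>z. cell_mean n V (u z) (v z)) \<in> borel_measurable N"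
  unfolding cell_mean_def by measurable

text \<open>The intermediate point \<open>(x', y)\<close> splits a move within a pair of cells into
  one in the first and one in the second variable, and the remaining kernel factor integrates to at
  most 1. Hence it suffices to control single sections.\<close>

lemma nn_integral_oscillation2_le:
  assumes V[measurable]: "(\<lambda>(x, y). V x y) \<in> borel_measurable (M \<Otimes>\<^sub>M M)"
  shows "(\<integral>\<^sup>+x. \<integral>\<^sup>+y. oscillation2 n V x y \<partial>M \<partial>M) \<le>
    (\<integral>\<^sup>+y. oscillation n (\<lambda>x. V x y) \<partial>M) + (\<integral>\<^sup>+x. oscillation n (V x) \<partial>M)"
proof -
  interpret P: pair_prob_space M M ..
  define k where "k x x' = ennreal (cell_kernel n (f x) (f x'))" for x x'
  define a where "a x x' y = ennreal (\<bar>V x y - V x' y\<bar> * cell_kernel n (f x) (f x'))" for x x' y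
  define b where "b x' y y' = ennreal (\<bar>V x' y - V x' y'\<bar> * cell_kernel n (f y) (f y'))" for x' y y'
  define B where "B x' y = (\<integral>\<^sup>+y'. b x' y y' \<partial>M)" for x' y
  have [measurable]: "(\<lambda>(x, x'). k x x') \<in> borel_measurable (M \<Otimes>\<^sub>M M)"
    unfolding k_def by measurable
  have [measurable]: "(\<lambda>z. a (u z) (v z) (w z)) \<in> borel_measurable N"
    "(\<lambda>z. b (u z) (v z) (w z)) \<in> borel_measurable N"
    if [measurable]: "u \<in> measurable N M" "v \<in> measurable N M" "w \<in> measurable N M" for u v w and N :: "'c measure"
    unfolding a_def b_def by measurable
  have Bm[measurable]: "(\<lambda>(x, y). B x y) \<in> borel_measurable (M \<Otimes>\<^sub>M M)"
    unfolding B_def b_def by measurable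
  have k_le: "(\<integral>\<^sup>+y'. k y y' \<partial>M) \<le> 1" for y
    unfolding k_def by (rule nn_integral_cell_kernel_le)
  have le: "oscillation2 n V x y \<le> (\<integral>\<^sup>+x'. a x x' y \<partial>M) + (\<integral>\<^sup>+x'. B x' y * k x x' \<partial>M)"
    if [measurable]: "x \<in> space M" "y \<in> space M" for x y
  proof -
    have "oscillation2 n V x y \<le> (\<integral>\<^sup>+x'. \<integral>\<^sup>+y'. a x x' y * k y y' + b x' y y' * k x x' \<partial>M \<partial>M)"
      unfolding oscillation2_def
    proof (intro nn_integral_mono)
      fix x' y'
      have "\<bar>V x y - V x' y'\<bar> \<le> \<bar>V x y - V x' y\<bar> + \<bar>V x' y - V x' y'\<bar>" by simp
      then have "ennreal \<bar>V x y - V x' y'\<bar> \<le> ennreal \<bar>V x y - V x' y\<bar> + ennreal \<bar>V x' y - V x' y'\<bar>"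
        by (subst ennreal_plus[symmetric]) (simp_all add: ennreal_leI del: ennreal_plus)
      then have "ennreal \<bar>V x y - V x' y'\<bar> * (k x x' * k y y')
          \<le> (ennreal \<bar>V x y - V x' y\<bar> + ennreal \<bar>V x' y - V x' y'\<bar>) * (k x x' * k y y')"
        by (intro mult_right_mono) auto
      also have "\<dots> = a x x' y * k y y' + b x' y y' * k x x'"
        unfolding a_def b_def k_def by (simp add: ennreal_mult cell_kernel_nonneg distrib_left distrib_right mult_ac)
      finally show "ennreal \<bar>V x y - V x' y'\<bar> * (ennreal (cell_kernel n (f x) (f x')) * ennreal (cell_kernel n (f y) (f y')))
          \<le> a x x' y * k y y' + b x' y y' * k x x'"
        unfolding k_def .
    qed
    also have "\<dots> = (\<integral>\<^sup>+x'. a x x' y * (\<integral>\<^sup>+y'. k y y' \<partial>M) + B x' y * k x x' \<partial>M)"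
    proof (intro nn_integral_cong)
      fix x' assume [measurable]: "x' \<in> space M"
      have "(\<integral>\<^sup>+y'. a x x' y * k y y' + b x' y y' * k x x' \<partial>M) =
          (\<integral>\<^sup>+y'. a x x' y * k y y' \<partial>M) + (\<integral>\<^sup>+y'. b x' y y' * k x x' \<partial>M)"
        by (rule nn_integral_add) measurable
      also have "(\<integral>\<^sup>+y'. a x x' y * k y y' \<partial>M) = a x x' y * (\<integral>\<^sup>+y'. k y y' \<partial>M)"
        by (rule nn_integral_cmult) measurable
      also have "(\<integral>\<^sup>+y'. b x' y y' * k x x' \<partial>M) = B x' y * k x x'"
        unfolding B_def by (rule nn_integral_multc) measurable
      finally show "(\<integral>\<^sup>+y'. a x x' y * k y y' + b x' y y' * k x x' \<partial>M) =
          a x x' y * (\<integral>\<^sup>+y'. k y y' \<partial>M) + B x' y * k x x'" .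
    qed
    also have "\<dots> \<le> (\<integral>\<^sup>+x'. a x x' y * 1 + B x' y * k x x' \<partial>M)"
      by (intro nn_integral_mono add_mono mult_left_mono k_le) auto
    also have "\<dots> = (\<integral>\<^sup>+x'. a x x' y \<partial>M) + (\<integral>\<^sup>+x'. B x' y * k x x' \<partial>M)"
      unfolding mult_1_right by (rule nn_integral_add) measurable
    finally show ?thesis .
  qed
  have "(\<integral>\<^sup>+x. \<integral>\<^sup>+y. oscillation2 n V x y \<partial>M \<partial>M) \<le>
      (\<integral>\<^sup>+x. \<integral>\<^sup>+y. (\<integral>\<^sup>+x'. a x x' y \<partial>M) + (\<integral>\<^sup>+x'. B x' y * k x x' \<partial>M) \<partial>M \<partial>M)"
    by (intro nn_integral_mono le)
  also have "\<dots> = (\<integral>\<^sup>+x. (\<integral>\<^sup>+y. \<integral>\<^sup>+x'. a x x' y \<partial>M \<partial>M) + (\<integral>\<^sup>+y. \<integral>\<^sup>+x'. B x' y * k x x' \<partial>M \<partial>M) \<partial>M)"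
    by (intro nn_integral_cong nn_integral_add) measurable
  also have "\<dots> = (\<integral>\<^sup>+x. \<integral>\<^sup>+y. \<integral>\<^sup>+x'. a x x' y \<partial>M \<partial>M \<partial>M) + (\<integral>\<^sup>+x. \<integral>\<^sup>+y. \<integral>\<^sup>+x'. B x' y * k x x' \<partial>M \<partial>M \<partial>M)"
    by (rule nn_integral_add) measurable
  also have "(\<integral>\<^sup>+x. \<integral>\<^sup>+y. \<integral>\<^sup>+x'. a x x' y \<partial>M \<partial>M \<partial>M) = (\<integral>\<^sup>+y. \<integral>\<^sup>+x. \<integral>\<^sup>+x'. a x x' y \<partial>M \<partial>M \<partial>M)"
    by (rule P.Fubini'[symmetric]) measurable
  also have "\<dots> = (\<integral>\<^sup>+y. oscillation n (\<lambda>x. V x y) \<partial>M)"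
    unfolding oscillation_def a_def ..
  also have "(\<integral>\<^sup>+x. \<integral>\<^sup>+y. \<integral>\<^sup>+x'. B x' y * k x x' \<partial>M \<partial>M \<partial>M) = (\<integral>\<^sup>+x. \<integral>\<^sup>+x'. (\<integral>\<^sup>+y. B x' y \<partial>M) * k x x' \<partial>M \<partial>M)"
  proof (rule nn_integral_cong)
    fix x assume [measurable]: "x \<in> space M"
    have "(\<integral>\<^sup>+y. \<integral>\<^sup>+x'. B x' y * k x x' \<partial>M \<partial>M) = (\<integral>\<^sup>+x'. \<integral>\<^sup>+y. B x' y * k x x' \<partial>M \<partial>M)"
      by (rule P.Fubini') measurable
    also have "\<dots> = (\<integral>\<^sup>+x'. (\<integral>\<^sup>+y. B x' y \<partial>M) * k x x' \<partial>M)"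
      by (intro nn_integral_cong nn_integral_multc) measurable
    finally show "(\<integral>\<^sup>+y. \<integral>\<^sup>+x'. B x' y * k x x' \<partial>M \<partial>M) = (\<integral>\<^sup>+x'. (\<integral>\<^sup>+y. B x' y \<partial>M) * k x x' \<partial>M)" .
  qed
  also have "(\<integral>\<^sup>+y. oscillation n (\<lambda>x. V x y) \<partial>M) + (\<integral>\<^sup>+x. \<integral>\<^sup>+x'. (\<integral>\<^sup>+y. B x' y \<partial>M) * k x x' \<partial>M \<partial>M)
      \<le> (\<integral>\<^sup>+y. oscillation n (\<lambda>x. V x y) \<partial>M) + (\<integral>\<^sup>+x. (\<integral>\<^sup>+y. B x y \<partial>M) \<partial>M)"
    unfolding k_def by (intro add_left_mono nn_integral_kernel_snd_le) measurable
  also have "(\<integral>\<^sup>+x. (\<integral>\<^sup>+y. B x y \<partial>M) \<partial>M) = (\<integral>\<^sup>+x. oscillation n (V x) \<partial>M)"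
    unfolding oscillation_def B_def b_def ..
  finally show ?thesis .
qed

text \<open>Convergence for each section is integrated over the other variable by dominated
  convergence; oscillations of functions into the unit interval are bounded by 1.\<close>

lemma nn_integral_oscillation2_tendsto_0:
  assumes V[measurable]: "(\<lambda>(x, y). V x y) \<in> borel_measurable (M \<Otimes>\<^sub>M M)"
    and range: "\<And>x y. x \<in> space M \<Longrightarrow> y \<in> space M \<Longrightarrow> V x y \<in> {0..1}"
    and col: "\<And>y. y \<in> space M \<Longrightarrow> (\<lambda>n. oscillation n (\<lambda>x. V x y)) \<longlonglongrightarrow> 0"
    and row: "\<And>x. x \<in> space M \<Longrightarrow> (\<lambda>n. oscillation n (V x)) \<longlonglongrightarrow> 0"
  shows "(\<lambda>n. \<integral>\<^sup>+p. (case p of (x, y) \<Rightarrow> oscillation2 n V x y) \<partial>(M \<Otimes>\<^sub>M M)) \<longlonglongrightarrow> 0"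
proof -
  interpret P: pair_prob_space M M ..
  have [measurable]: "(\<lambda>y. oscillation n (\<lambda>x. V x y)) \<in> borel_measurable M" for n
    unfolding oscillation_def by measurable
  have [measurable]: "(\<lambda>x. oscillation n (V x)) \<in> borel_measurable M" for n
    unfolding oscillation_def by measurable
  have diff: "\<bar>V x y - V x' y'\<bar> \<le> 1" if "x \<in> space M" "x' \<in> space M" "y \<in> space M" "y' \<in> space M" for x x' y y'
    using range[of x y] range[of x' y'] that by auto
  have "(\<lambda>n. \<integral>\<^sup>+y. oscillation n (\<lambda>x. V x y) \<partial>M) \<longlonglongrightarrow> (\<integral>\<^sup>+y. 0 \<partial>M)"
    by (rule nn_integral_dominated_convergence[where w="\<lambda>_. 1"])
      (auto intro!: AE_I2 oscillation_le diff col simp: emeasure_space_1)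
  moreover have "(\<lambda>n. \<integral>\<^sup>+x. oscillation n (V x) \<partial>M) \<longlonglongrightarrow> (\<integral>\<^sup>+x. 0 \<partial>M)"
    by (rule nn_integral_dominated_convergence[where w="\<lambda>_. 1"])
      (auto intro!: AE_I2 oscillation_le diff row simp: emeasure_space_1)
  ultimately have "(\<lambda>n. (\<integral>\<^sup>+y. oscillation n (\<lambda>x. V x y) \<partial>M) + (\<integral>\<^sup>+x. oscillation n (V x) \<partial>M)) \<longlonglongrightarrow> 0"
    using tendsto_add by fastforce
  moreover have "(\<integral>\<^sup>+p. (case p of (x, y) \<Rightarrow> oscillation2 n V x y) \<partial>(M \<Otimes>\<^sub>M M)) \<le>
      (\<integral>\<^sup>+y. oscillation n (\<lambda>x. V x y) \<partial>M) + (\<integral>\<^sup>+x. oscillation n (V x) \<partial>M)" for n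
    using nn_integral_oscillation2_le[OF V, of n] nn_integral_fst[OF borel_measurable_oscillation2[OF V, of n]] by simp
  ultimately show ?thesis by (rule ennreal_tendsto_0_le[rotated])
qed

lemma nn_integral_cell_kernel2:
  assumes "s \<in> {0..<1}" "t \<in> {0..<1}"
  shows "(\<integral>\<^sup>+x. \<integral>\<^sup>+y. c * (ennreal (cell_kernel n s (f x)) * ennreal (cell_kernel n t (f y))) \<partial>M \<partial>M) = c"
proof -
  have "(\<integral>\<^sup>+x. \<integral>\<^sup>+y. c * (ennreal (cell_kernel n s (f x)) * ennreal (cell_kernel n t (f y))) \<partial>M \<partial>M) =
      (\<integral>\<^sup>+x. c * (ennreal (cell_kernel n s (f x)) * (\<integral>\<^sup>+y. ennreal (cell_kernel n t (f y)) \<partial>M)) \<partial>M)"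
    by (simp add: nn_integral_cmult)
  also have "\<dots> = c * (\<integral>\<^sup>+x. ennreal (cell_kernel n s (f x)) \<partial>M)"
    using assms by (simp add: nn_integral_cell_kernel_eq nn_integral_cmult)
  finally show ?thesis using assms by (simp add: nn_integral_cell_kernel_eq)
qed

lemma cell_mean_mono:
  assumes "\<And>x y. x \<in> space M \<Longrightarrow> y \<in> space M \<Longrightarrow> V x y \<le> V' x y"
  shows "cell_mean n V s t \<le> cell_mean n V' s t"
  unfolding cell_mean_def using assms by (intro nn_integral_mono mult_right_mono ennreal_leI) auto

lemma cell_mean_le_1:
  assumes "\<And>x y. x \<in> space M \<Longrightarrow> y \<in> space M \<Longrightarrow> V x y \<le> 1" "s \<in> {0..<1}" "t \<in> {0..<1}"
  shows "cell_mean n V s t \<le> 1"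
proof -
  have "cell_mean n V s t \<le> cell_mean n (\<lambda>_ _. 1) s t" using assms(1) by (rule cell_mean_mono)
  also have "\<dots> = 1" unfolding cell_mean_def using nn_integral_cell_kernel2[OF assms(2,3), of 1] by simp
  finally show ?thesis .
qed

text \<open>Average the triangle inequality for \<open>V x y\<close> and \<open>V x' y'\<close> over
  the pair of cells; the weights have total mass 1 since \<open>f x\<close> and \<open>f y\<close>
  are below 1.\<close>

lemma cell_mean_near:
  assumes [measurable]: "(\<lambda>(x, y). V x y) \<in> borel_measurable (M \<Otimes>\<^sub>M M)"
    and xy[measurable]: "x \<in> space M" "y \<in> space M" and fxy: "f x < 1" "f y < 1"
  shows "cell_mean n V (f x) (f y) \<le> ennreal (V x y) + oscillation2 n V x y"
    and "ennreal (V x y) \<le> cell_mean n V (f x) (f y) + oscillation2 n V x y"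
proof -
  define K where "K x' y' = ennreal (cell_kernel n (f x) (f x')) * ennreal (cell_kernel n (f y) (f y'))" for x' y'
  have [measurable]: "(\<lambda>(x', y'). K x' y') \<in> borel_measurable (M \<Otimes>\<^sub>M M)" unfolding K_def by measurable
  have st: "f x \<in> {0..<1}" "f y \<in> {0..<1}" using range_f xy fxy by auto
  have int: "(\<integral>\<^sup>+x'. \<integral>\<^sup>+y'. (u x' y' + ennreal \<bar>V x y - V x' y'\<bar>) * K x' y' \<partial>M \<partial>M) =
      (\<integral>\<^sup>+x'. \<integral>\<^sup>+y'. u x' y' * K x' y' \<partial>M \<partial>M) + oscillation2 n V x y"
    if [measurable]: "(\<lambda>(x, y). u x y) \<in> borel_measurable (M \<Otimes>\<^sub>M M)" for u
  proof -
    have "(\<integral>\<^sup>+x'. \<integral>\<^sup>+y'. (u x' y' + ennreal \<bar>V x y - V x' y'\<bar>) * K x' y' \<partial>M \<partial>M) =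
        (\<integral>\<^sup>+x'. (\<integral>\<^sup>+y'. u x' y' * K x' y' \<partial>M) + (\<integral>\<^sup>+y'. ennreal \<bar>V x y - V x' y'\<bar> * K x' y' \<partial>M) \<partial>M)"
      unfolding distrib_right by (intro nn_integral_cong nn_integral_add) measurable
    also have "\<dots> = (\<integral>\<^sup>+x'. \<integral>\<^sup>+y'. u x' y' * K x' y' \<partial>M \<partial>M) +
        (\<integral>\<^sup>+x'. \<integral>\<^sup>+y'. ennreal \<bar>V x y - V x' y'\<bar> * K x' y' \<partial>M \<partial>M)"
      by (rule nn_integral_add) measurable
    finally show ?thesis unfolding oscillation2_def K_def .
  qed
  have c: "(\<integral>\<^sup>+x'. \<integral>\<^sup>+y'. ennreal (V x y) * K x' y' \<partial>M \<partial>M) = ennreal (V x y)"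
    unfolding K_def by (rule nn_integral_cell_kernel2[OF st])
  have tri: "ennreal a \<le> ennreal b + ennreal \<bar>d\<bar>" if "a \<le> b + \<bar>d\<bar>" for a b d :: real
    using that by (cases "0 \<le> b") (auto simp: ennreal_plus[symmetric] ennreal_neg intro!: ennreal_leI simp del: ennreal_plus)
  have "cell_mean n V (f x) (f y) \<le> (\<integral>\<^sup>+x'. \<integral>\<^sup>+y'. (ennreal (V x y) + ennreal \<bar>V x y - V x' y'\<bar>) * K x' y' \<partial>M \<partial>M)"
    unfolding cell_mean_def K_def[symmetric] by (intro nn_integral_mono mult_right_mono tri) auto
  then show "cell_mean n V (f x) (f y) \<le> ennreal (V x y) + oscillation2 n V x y"
    by (simp add: int c)
  have "ennreal (V x y) \<le> (\<integral>\<^sup>+x'. \<integral>\<^sup>+y'. (ennreal (V x' y') + ennreal \<bar>V x y - V x' y'\<bar>) * K x' y' \<partial>M \<partial>M)"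
    by (subst c[symmetric], intro nn_integral_mono mult_right_mono tri) auto
  then show "ennreal (V x y) \<le> cell_mean n V (f x) (f y) + oscillation2 n V x y"
    unfolding cell_mean_def K_def[symmetric] by (simp add: int)
qed

lemma cell_mean_tendsto:
  assumes V: "(\<lambda>(x, y). V x y) \<in> borel_measurable (M \<Otimes>\<^sub>M M)"
    and xy: "x \<in> space M" "y \<in> space M" "f x < 1" "f y < 1"
    and lim: "(\<lambda>k. oscillation2 (r k) V x y) \<longlonglongrightarrow> 0"
  shows "(\<lambda>k. cell_mean (r k) V (f x) (f y)) \<longlonglongrightarrow> ennreal (V x y)"
proof (rule tendsto_sandwich)
  show "(\<lambda>k. ennreal (V x y) - oscillation2 (r k) V x y) \<longlonglongrightarrow> ennreal (V x y)"
    using tendsto_diff_ennreal[OF tendsto_const lim, of "ennreal (V x y)"] by simp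
  show "(\<lambda>k. ennreal (V x y) + oscillation2 (r k) V x y) \<longlonglongrightarrow> ennreal (V x y)"
    using tendsto_add[OF tendsto_const lim, of "ennreal (V x y)"] by simp
  show "\<forall>\<^sub>F k in sequentially. ennreal (V x y) - oscillation2 (r k) V x y \<le> cell_mean (r k) V (f x) (f y)"
    using cell_mean_near(2)[OF V xy] by (intro always_eventually allI) (simp add: ennreal_minus_le_iff add.commute)
  show "\<forall>\<^sub>F k in sequentially. cell_mean (r k) V (f x) (f y) \<le> ennreal (V x y) + oscillation2 (r k) V x y"
    using cell_mean_near(1)[OF V xy] by (intro always_eventually allI)
qed

text \<open>\<open>tri\<close> is an additive form of the kernel axiom. It is weighted with the
  product of three cell densities of mass 1, and in each term the variable that does not occur is
  integrated out. In effect this is a union bound: if both pairs of cells have nearly full density,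
  few triples of points fail one of the two relations.\<close>

lemma cell_mean_triangle:
  assumes P[measurable]: "(\<lambda>(x, y). P x y) \<in> borel_measurable (M \<Otimes>\<^sub>M M)"
    and V[measurable]: "(\<lambda>(x, y). V x y) \<in> borel_measurable (M \<Otimes>\<^sub>M M)"
    and nonneg: "\<And>a b. a \<in> space M \<Longrightarrow> b \<in> space M \<Longrightarrow> 0 \<le> P a b" "\<And>a b. a \<in> space M \<Longrightarrow> b \<in> space M \<Longrightarrow> 0 \<le> V a b"
    and tri: "\<And>a b c. a \<in> space M \<Longrightarrow> b \<in> space M \<Longrightarrow> c \<in> space M \<Longrightarrow> P a b + P b c \<le> V a c + 1"
    and st: "s \<in> {0..<1}" "t \<in> {0..<1}" "r \<in> {0..<1}"
  shows "cell_mean n P s t + cell_mean n P t r \<le> cell_mean n V s r + 1"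
proof -
  define k where "k s x = ennreal (cell_kernel n s (f x))" for s x
  have [measurable]: "k s \<in> borel_measurable M" for s unfolding k_def by measurable
  have int_k: "(\<integral>\<^sup>+x. k s x \<partial>M) = 1" if "s \<in> {0..<1}" for s
    unfolding k_def using that by (intro nn_integral_cell_kernel_eq) auto
  have 1: "(\<integral>\<^sup>+a. \<integral>\<^sup>+b. \<integral>\<^sup>+c. ennreal (P a b) * (k s a * k t b * k r c) \<partial>M \<partial>M \<partial>M) = cell_mean n P s t"
  proof -
    have "(\<integral>\<^sup>+c. ennreal (P a b) * (k s a * k t b * k r c) \<partial>M) = ennreal (P a b) * (k s a * k t b)" for a b
    proof -
      have "(\<integral>\<^sup>+c. ennreal (P a b) * (k s a * k t b) * k r c \<partial>M) = ennreal (P a b) * (k s a * k t b) * (\<integral>\<^sup>+c. k r c \<partial>M)"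
        by (rule nn_integral_cmult) measurable
      then show ?thesis using int_k[OF st(3)] by (simp add: mult.assoc)
    qed
    then show ?thesis unfolding cell_mean_def k_def by simp
  qed
  have 2: "(\<integral>\<^sup>+a. \<integral>\<^sup>+b. \<integral>\<^sup>+c. ennreal (P b c) * (k s a * k t b * k r c) \<partial>M \<partial>M \<partial>M) = cell_mean n P t r"
  proof -
    define J where "J = (\<integral>\<^sup>+b. \<integral>\<^sup>+c. ennreal (P b c) * (k t b * k r c) \<partial>M \<partial>M)"
    have "(\<integral>\<^sup>+b. \<integral>\<^sup>+c. ennreal (P b c) * (k s a * k t b * k r c) \<partial>M \<partial>M) = k s a * J" for a
    proof -
      have "(\<integral>\<^sup>+b. \<integral>\<^sup>+c. ennreal (P b c) * (k s a * k t b * k r c) \<partial>M \<partial>M) =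
          (\<integral>\<^sup>+b. \<integral>\<^sup>+c. k s a * (ennreal (P b c) * (k t b * k r c)) \<partial>M \<partial>M)"
        by (simp only: ac_simps)
      also have "\<dots> = (\<integral>\<^sup>+b. k s a * (\<integral>\<^sup>+c. ennreal (P b c) * (k t b * k r c) \<partial>M) \<partial>M)"
        by (intro nn_integral_cong nn_integral_cmult) measurable
      also have "\<dots> = k s a * J" unfolding J_def by (rule nn_integral_cmult) measurable
      finally show ?thesis .
    qed
    then have "(\<integral>\<^sup>+a. \<integral>\<^sup>+b. \<integral>\<^sup>+c. ennreal (P b c) * (k s a * k t b * k r c) \<partial>M \<partial>M \<partial>M) = (\<integral>\<^sup>+a. k s a \<partial>M) * J"
      by (simp add: nn_integral_multc)
    then show ?thesis using int_k[OF st(1)] unfolding J_def cell_mean_def k_def by simp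
  qed
  have 3: "(\<integral>\<^sup>+a. \<integral>\<^sup>+b. \<integral>\<^sup>+c. ennreal (V a c) * (k s a * k t b * k r c) \<partial>M \<partial>M \<partial>M) = cell_mean n V s r"
  proof -
    have "(\<integral>\<^sup>+b. \<integral>\<^sup>+c. ennreal (V a c) * (k s a * k t b * k r c) \<partial>M \<partial>M) = (\<integral>\<^sup>+c. ennreal (V a c) * (k s a * k r c) \<partial>M)"
      if [measurable]: "a \<in> space M" for a
    proof -
      have "(\<integral>\<^sup>+b. \<integral>\<^sup>+c. ennreal (V a c) * (k s a * k t b * k r c) \<partial>M \<partial>M) =
          (\<integral>\<^sup>+b. \<integral>\<^sup>+c. k t b * (ennreal (V a c) * (k s a * k r c)) \<partial>M \<partial>M)"
        by (simp only: ac_simps)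
      also have "\<dots> = (\<integral>\<^sup>+b. k t b * (\<integral>\<^sup>+c. ennreal (V a c) * (k s a * k r c) \<partial>M) \<partial>M)"
        by (intro nn_integral_cong nn_integral_cmult) measurable
      also have "\<dots> = (\<integral>\<^sup>+b. k t b \<partial>M) * (\<integral>\<^sup>+c. ennreal (V a c) * (k s a * k r c) \<partial>M)"
        by (rule nn_integral_multc) measurable
      finally show ?thesis using int_k[OF st(2)] by simp
    qed
    then show ?thesis unfolding cell_mean_def k_def by (simp cong: nn_integral_cong)
  qed
  have 4: "(\<integral>\<^sup>+a. \<integral>\<^sup>+b. \<integral>\<^sup>+c. k s a * k t b * k r c \<partial>M \<partial>M \<partial>M) = 1"
    by (simp add: nn_integral_cmult nn_integral_multc int_k[OF st(1)] int_k[OF st(2)] int_k[OF st(3)])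
  have "cell_mean n P s t + cell_mean n P t r =
      (\<integral>\<^sup>+a. \<integral>\<^sup>+b. \<integral>\<^sup>+c. ennreal (P a b) * (k s a * k t b * k r c) + ennreal (P b c) * (k s a * k t b * k r c) \<partial>M \<partial>M \<partial>M)"
    unfolding 1[symmetric] 2[symmetric] by (simp add: nn_integral_add cong: nn_integral_cong)
  also have "\<dots> \<le> (\<integral>\<^sup>+a. \<integral>\<^sup>+b. \<integral>\<^sup>+c. ennreal (V a c) * (k s a * k t b * k r c) + k s a * k t b * k r c \<partial>M \<partial>M \<partial>M)"
  proof (intro nn_integral_mono)
    fix a b c assume abc: "a \<in> space M" "b \<in> space M" "c \<in> space M"
    have "ennreal (P a b) + ennreal (P b c) \<le> ennreal (V a c) + ennreal 1"
      using tri[OF abc] nonneg abc by (simp add: ennreal_plus[symmetric] ennreal_leI del: ennreal_plus ennreal_1)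
    then have "(ennreal (P a b) + ennreal (P b c)) * (k s a * k t b * k r c) \<le> (ennreal (V a c) + ennreal 1) * (k s a * k t b * k r c)"
      by (rule mult_right_mono) simp
    then show "ennreal (P a b) * (k s a * k t b * k r c) + ennreal (P b c) * (k s a * k t b * k r c)
        \<le> ennreal (V a c) * (k s a * k t b * k r c) + k s a * k t b * k r c"
      by (simp add: distrib_right)
  qed
  also have "\<dots> = cell_mean n V s r + 1"
    unfolding 3[symmetric] 4[symmetric] by (simp add: nn_integral_add cong: nn_integral_cong)
  finally show ?thesis .
qed

end

subsection \<open>The kernel on the unit interval\<close>

lemma sets_less_unit_interval:
  "{(s, t). s \<in> space unit_interval \<and> t \<in> space unit_interval \<and> s < t} \<in> sets (unit_interval \<Otimes>\<^sub>M unit_interval)"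
proof -
  have [measurable]: "(\<lambda>x. x) \<in> borel_measurable unit_interval"
    by (intro measurable_restrict_space1) simp
  have "{p \<in> space (unit_interval \<Otimes>\<^sub>M unit_interval). fst p < snd p} \<in> sets (unit_interval \<Otimes>\<^sub>M unit_interval)"
    by measurable
  also have "{p \<in> space (unit_interval \<Otimes>\<^sub>M unit_interval). fst p < snd p} =
      {(s, t). s \<in> space unit_interval \<and> t \<in> space unit_interval \<and> s < t}"
    by (auto simp: space_pair_measure)
  finally show ?thesis .
qed

lemma ordered_prob_space_unit_interval: "ordered_prob_space unit_interval (<)"
  by (intro ordered_prob_space.intro ordered_prob_space_axioms.intro prob_space_unit_interval sets_less_unit_interval)
    (auto simp: transp_on_def irreflp_on_def)

text \<open>For every choice of \<open>r\<close> the constructed function is a kernel at all points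
  of the square. The choice matters only for the agreement with \<open>W\<close>, which is asserted
  at points where both oscillations tend to 0.\<close>

lemma (in uniform_variable) exists_cell_limit_kernel:
  fixes W :: "'a \<Rightarrow> 'a \<Rightarrow> real" and r :: "nat \<Rightarrow> nat"
  assumes W[measurable]: "(\<lambda>(x, y). W x y) \<in> borel_measurable (M \<Otimes>\<^sub>M M)"
    and range: "\<And>x y. x \<in> space M \<Longrightarrow> y \<in> space M \<Longrightarrow> W x y \<in> {0..1}"
    and trans: "\<And>x y z. x \<in> space M \<Longrightarrow> y \<in> space M \<Longrightarrow> z \<in> space M \<Longrightarrow> W x y > 0 \<Longrightarrow> W y z > 0 \<Longrightarrow> W x z = 1"
  shows "\<exists>U. poset_kernel unit_interval (<) U \<and>
    (\<forall>x\<in>space M. \<forall>y\<in>space M. (W x y > 0 \<longrightarrow> f x < f y) \<longrightarrow> f x < 1 \<longrightarrow> f y < 1 \<longrightarrow>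
      (\<lambda>k. oscillation2 (r k) W x y) \<longlonglongrightarrow> 0 \<longrightarrow> (\<lambda>k. oscillation2 (r k) (\<lambda>x y. of_bool (W x y > 0)) x y) \<longlonglongrightarrow> 0 \<longrightarrow>
      U (f x) (f y) = W x y)"
proof -
  define P where "P = (\<lambda>x y. of_bool (W x y > 0) :: real)"
  interpret I: ordered_prob_space unit_interval "(<)" by (rule ordered_prob_space_unit_interval)
  have P[measurable]: "(\<lambda>(x, y). P x y) \<in> borel_measurable (M \<Otimes>\<^sub>M M)"
    unfolding P_def by measurable
  define m where "m k s t = cell_mean (r k) W s t" for k s t
  define p where "p k s t = cell_mean (r k) P s t" for k s t
  \<comment> \<open>\<open>limsup\<close> gives a measurable value even where the averages diverge.
    The bounds keep \<open>s\<close> and \<open>t\<close> in \<open>{0..<1}\<close>, where cells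
    have full mass, and \<open>s < t\<close> secures the order axiom. The default 0 cannot violate
    the kernel axiom, whose premises ask for positive values.\<close>
  define U where "U s t = (if s < t \<and> 0 \<le> s \<and> t < 1 \<and> 1 \<le> liminf (\<lambda>k. p k s t)
      then enn2real (limsup (\<lambda>k. m k s t)) else 0)" for s t
  have m_le: "m k s t \<le> 1" and p_le: "p k s t \<le> 1" if "s \<in> {0..<1}" "t \<in> {0..<1}" for k s t
    unfolding m_def p_def using range that by (auto intro!: cell_mean_le_1 simp: P_def)
  have m_p: "m k s t \<le> p k s t" for k s t
    unfolding m_def p_def using range by (intro cell_mean_mono) (force simp: P_def of_bool_def)
  have triangle: "p k s t + p k t u \<le> m k s u + 1" if "s \<in> {0..<1}" "t \<in> {0..<1}" "u \<in> {0..<1}" for k s t u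
    unfolding m_def p_def
  proof (rule cell_mean_triangle[OF P W _ _ _ that])
    fix a b c assume abc: "a \<in> space M" "b \<in> space M" "c \<in> space M"
    show "P a b + P b c \<le> W a c + 1"
      using trans[OF abc] range[OF abc(1,3)] unfolding P_def by (cases "W a b > 0"; cases "W b c > 0") auto
  qed (use range in \<open>auto simp: P_def\<close>)
  have limsup_le: "limsup (\<lambda>k. m k s t) \<le> 1" if "s \<in> {0..<1}" "t \<in> {0..<1}" for s t
    using m_le[OF that] by (intro Limsup_bounded) simp
  have p_lim: "(\<lambda>k. p k s t) \<longlonglongrightarrow> 1" if "s \<in> {0..<1}" "t \<in> {0..<1}" "1 \<le> liminf (\<lambda>k. p k s t)" for s t
  proof -
    have "limsup (\<lambda>k. p k s t) \<le> 1" using p_le[OF that(1,2)] by (intro Limsup_bounded) simp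
    moreover have "liminf (\<lambda>k. p k s t) \<le> limsup (\<lambda>k. p k s t)" by (simp add: Liminf_le_Limsup)
    ultimately have "liminf (\<lambda>k. p k s t) = 1" "limsup (\<lambda>k. p k s t) = 1" using that(3) by auto
    then show ?thesis by (simp add: tendsto_iff_Liminf_eq_Limsup)
  qed
  have U_pos: "s < t \<and> s \<in> {0..<1} \<and> t \<in> {0..<1} \<and> (\<lambda>k. p k s t) \<longlonglongrightarrow> 1" if "U s t > 0" for s t
    using that p_lim[of s t] unfolding U_def by (auto split: if_splits)
  have "poset_kernel unit_interval (<) U"
  proof
    fix s t :: real
    have "enn2real (limsup (\<lambda>k. m k s t)) \<le> 1" if "s \<in> {0..<1}" "t \<in> {0..<1}"
      using limsup_le[OF that] by (intro enn2real_leI) simp_all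
    then show "U s t \<in> {0..1}" unfolding U_def by simp
    show "s < t" if "U s t > 0" using U_pos[OF that] by simp
  next
    have id[measurable]: "(\<lambda>x. x) \<in> borel_measurable unit_interval"
      by (intro measurable_restrict_space1) simp
    have [measurable]: "(\<lambda>z. m k (fst z) (snd z)) \<in> borel_measurable (unit_interval \<Otimes>\<^sub>M unit_interval)"
      "(\<lambda>z. p k (fst z) (snd z)) \<in> borel_measurable (unit_interval \<Otimes>\<^sub>M unit_interval)" for k
      unfolding m_def p_def by (auto intro!: borel_measurable_cell_mean W P measurable_compose[OF measurable_fst id] measurable_compose[OF measurable_snd id])
    show "(\<lambda>(s, t). U s t) \<in> borel_measurable (unit_interval \<Otimes>\<^sub>M unit_interval)"
      unfolding U_def case_prod_unfold by measurable
  next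
    fix s t u :: real
    assume st: "U s t > 0" and tu: "U t u > 0"
    note st = U_pos[OF st] and tu = U_pos[OF tu]
    \<comment> \<open>This lower bound for \<open>m k s u\<close> tends to 1. As \<open>m\<close> is
      at most \<open>p\<close>, the pair \<open>(s, u)\<close> has full density too, so
      \<open>U s u\<close> is given by its first branch and equals 1.\<close>
    have "(\<lambda>k. p k s t + p k t u - 1) \<longlonglongrightarrow> 1 + 1 - 1"
      using st tu by (intro tendsto_diff_ennreal tendsto_add tendsto_const) auto
    moreover have "(1::ennreal) + 1 - 1 = 1" by (rule ennreal_add_diff_cancel_left) simp
    ultimately have lower: "(\<lambda>k. p k s t + p k t u - 1) \<longlonglongrightarrow> 1" by (simp only:)
    have su: "s < u" "s \<in> {0..<1}" "u \<in> {0..<1}" using st tu by auto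
    have le: "p k s t + p k t u - 1 \<le> m k s u" for k
      using triangle[of s t u k] st tu by (simp add: ennreal_minus_le_iff add.commute)
    have squeeze: "b \<longlonglongrightarrow> 1" if "a \<longlonglongrightarrow> 1" "\<And>k. a k \<le> b k" "\<And>k. b k \<le> 1" for a b :: "nat \<Rightarrow> ennreal"
      using that by (intro tendsto_sandwich[OF always_eventually always_eventually that(1) tendsto_const] allI)
    have m1: "(\<lambda>k. m k s u) \<longlonglongrightarrow> 1"
      using lower le m_le[OF su(2,3)] by (rule squeeze)
    have p1: "(\<lambda>k. p k s u) \<longlonglongrightarrow> 1"
      using m1 m_p p_le[OF su(2,3)] by (rule squeeze)
    show "U s u = 1"
      using su lim_imp_Limsup[OF _ m1] lim_imp_Liminf[OF _ p1] unfolding U_def by simp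
  qed
  moreover have "U (f x) (f y) = W x y"
    if xy: "x \<in> space M" "y \<in> space M" "W x y > 0 \<longrightarrow> f x < f y" "f x < 1" "f y < 1"
      "(\<lambda>k. oscillation2 (r k) W x y) \<longlonglongrightarrow> 0" "(\<lambda>k. oscillation2 (r k) P x y) \<longlonglongrightarrow> 0" for x y
  proof -
    have m: "(\<lambda>k. m k (f x) (f y)) \<longlonglongrightarrow> ennreal (W x y)"
      unfolding m_def using xy by (intro cell_mean_tendsto W)
    have p: "(\<lambda>k. p k (f x) (f y)) \<longlonglongrightarrow> ennreal (P x y)"
      unfolding p_def using xy by (intro cell_mean_tendsto P)
    note lims = lim_imp_Limsup[OF _ m] lim_imp_Liminf[OF _ p]
    show ?thesis
    proof (cases "W x y > 0")
      case True
      then show ?thesis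
        using lims xy range_f[OF xy(1)] range[OF xy(1,2)] unfolding U_def by (simp add: P_def)
    next
      \<comment> \<open>Here \<open>W x y = 0\<close>, and both branches of \<open>U\<close> give
        0.\<close>
      case False
      then show ?thesis
        using lims range[OF xy(1,2)] unfolding U_def by (auto simp: P_def)
    qed
  qed
  ultimately show ?thesis unfolding P_def[symmetric] by blast
qed

text \<open>\<open>U\<close> combines averages of \<open>W\<close> and of the indicator of
  \<open>{W > 0}\<close> along the same indices; adding the two oscillations yields one sequence
  that serves both.\<close>

lemma (in uniform_variable) exists_oscillation2_subsequence:
  fixes V V' :: "'a \<Rightarrow> 'a \<Rightarrow> real"
  assumes V: "(\<lambda>(x, y). V x y) \<in> borel_measurable (M \<Otimes>\<^sub>M M)" "(\<lambda>(x, y). V' x y) \<in> borel_measurable (M \<Otimes>\<^sub>M M)"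
    and lim: "(\<lambda>n. \<integral>\<^sup>+p. (case p of (x, y) \<Rightarrow> oscillation2 n V x y) \<partial>(M \<Otimes>\<^sub>M M)) \<longlonglongrightarrow> 0"
      "(\<lambda>n. \<integral>\<^sup>+p. (case p of (x, y) \<Rightarrow> oscillation2 n V' x y) \<partial>(M \<Otimes>\<^sub>M M)) \<longlonglongrightarrow> 0"
  shows "\<exists>r. AE (x, y) in M \<Otimes>\<^sub>M M. (\<lambda>k. oscillation2 (r k) V x y) \<longlonglongrightarrow> 0 \<and> (\<lambda>k. oscillation2 (r k) V' x y) \<longlonglongrightarrow> 0"
proof -
  define u where "u n p = (case p of (x, y) \<Rightarrow> oscillation2 n V x y) + (case p of (x, y) \<Rightarrow> oscillation2 n V' x y)" for n p
  note [measurable] = borel_measurable_oscillation2[OF V(1)] borel_measurable_oscillation2[OF V(2)]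
  have "(\<integral>\<^sup>+p. u n p \<partial>(M \<Otimes>\<^sub>M M)) = (\<integral>\<^sup>+p. (case p of (x, y) \<Rightarrow> oscillation2 n V x y) \<partial>(M \<Otimes>\<^sub>M M)) +
      (\<integral>\<^sup>+p. (case p of (x, y) \<Rightarrow> oscillation2 n V' x y) \<partial>(M \<Otimes>\<^sub>M M))" for n
    unfolding u_def by (rule nn_integral_add) measurable
  then have "(\<lambda>n. \<integral>\<^sup>+p. u n p \<partial>(M \<Otimes>\<^sub>M M)) \<longlonglongrightarrow> 0"
    using tendsto_add[OF lim] by simp
  then obtain r :: "nat \<Rightarrow> nat" where "AE p in M \<Otimes>\<^sub>M M. (\<lambda>k. u (r k) p) \<longlonglongrightarrow> 0"
    using nn_integral_tendsto_0_AE_subseq[of u "M \<Otimes>\<^sub>M M"] unfolding u_def by auto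
  then have "AE (x, y) in M \<Otimes>\<^sub>M M. (\<lambda>k. oscillation2 (r k) V x y) \<longlonglongrightarrow> 0 \<and> (\<lambda>k. oscillation2 (r k) V' x y) \<longlonglongrightarrow> 0"
  proof eventually_elim
    case (elim p)
    obtain x y where p: "p = (x, y)" by (cases p)
    have u: "(\<lambda>k. oscillation2 (r k) V x y + oscillation2 (r k) V' x y) \<longlonglongrightarrow> 0"
      using elim by (simp add: u_def p)
    have "(\<lambda>k. oscillation2 (r k) V x y) \<longlonglongrightarrow> 0" by (rule ennreal_tendsto_0_le[OF _ u]) simp
    moreover have "(\<lambda>k. oscillation2 (r k) V' x y) \<longlonglongrightarrow> 0" by (rule ennreal_tendsto_0_le[OF _ u]) simp
    ultimately show ?case by (simp add: p)
  qed
  then show ?thesis by blast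
qed

theorem theorem1p9:
  fixes M :: "'a measure" and lt :: "'a \<Rightarrow> 'a \<Rightarrow> bool" and W :: "'a \<Rightarrow> 'a \<Rightarrow> real"
  assumes "strict_poset_kernel M lt W"
    and "atomless M"
  shows "\<exists>(U :: real \<Rightarrow> real \<Rightarrow> real) (f :: 'a \<Rightarrow> real).
    poset_kernel unit_interval (<) U \<and>
    poset_inclusion M lt unit_interval (<) f \<and>
    (AE (x, y) in M \<Otimes>\<^sub>M M. W x y = pull_back U f x y)"
proof -
  interpret strict_poset_kernel M lt W by fact
  interpret MM: pair_prob_space M M ..
  note W[measurable] = kernel_measurable
  obtain L :: "nat \<Rightarrow> 'a set" where L: "\<And>i. lower_set (L i)" "\<And>q. q \<in> \<rat> \<Longrightarrow> \<exists>i. L i = {y \<in> space M. depth y < q}"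
    and col: "\<And>q y e. q \<in> \<rat> \<Longrightarrow> 0 \<le> q \<Longrightarrow> y \<in> space M \<Longrightarrow> 0 < e \<Longrightarrow>
      \<exists>i. measure M (sym_diff {x \<in> space M. q < W x y} (L i)) < e"
    and row: "\<And>q x e. q \<in> \<rat> \<Longrightarrow> 0 \<le> q \<Longrightarrow> x \<in> space M \<Longrightarrow> 0 < e \<Longrightarrow>
      \<exists>i. measure M (sym_diff {y \<in> space M. W x y \<le> q} (L i)) < e"
  proof (rule dense_sequence_of_lower_sets, goal_cases)
    case (1 L)
    from 1(2-5) show ?case by (rule 1(1))
  qed
  obtain f where f: "uniform_variable M f"
    and mono: "AE (x, y) in M \<Otimes>\<^sub>M M. lt x y \<longrightarrow> f x < f y"
    and f_L: "\<And>u. \<exists>p. \<forall>x\<in>space M. (f x < p \<longrightarrow> ternary_code L x < u) \<and> (ternary_code L x < u \<longrightarrow> f x \<le> p)"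
  proof (rule uniform_monotone_variable[where L=L, OF assms(2) L(1)], goal_cases)
    case (1 q)
    from 1(2) show ?case by (rule L(2))
  next
    case (2 f)
    from 2(2-4) show ?case by (rule 2(1))
  qed
  interpret uniform_variable M f by fact
  have L_res: "L i \<in> resolved_sets" for i
    using L(1) f_L by (intro resolved_sets_ternary_code) (auto simp: lower_set_def)
  have col_res: "{x \<in> space M. q < W x y} \<in> resolved_sets" if "q \<in> \<rat>" "0 \<le> q" "y \<in> space M" for q y
  proof (rule resolved_sets_closure)
    show "{x \<in> space M. q < W x y} \<in> sets M" using that by measurable
  qed (use col[OF that] L_res in blast)
  \<comment> \<open>In the second variable the superlevel sets are complements of lower sets, so
    they are reached through closure under complements.\<close>
  have row_res: "{y \<in> space M. q < W x y} \<in> resolved_sets" if "q \<in> \<rat>" "0 \<le> q" "x \<in> space M" for q x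
  proof -
    have "{y \<in> space M. W x y \<le> q} \<in> resolved_sets"
    proof (rule resolved_sets_closure)
      show "{y \<in> space M. W x y \<le> q} \<in> sets M" using that by measurable
    qed (use row[OF that] L_res in blast)
    then have "space M - {y \<in> space M. W x y \<le> q} \<in> resolved_sets"
      using sigma_algebra_resolved_sets by (simp add: sigma_algebra_iff2)
    also have "space M - {y \<in> space M. W x y \<le> q} = {y \<in> space M. q < W x y}" by auto
    finally show ?thesis .
  qed
  define P where "P = (\<lambda>x y. of_bool (W x y > 0) :: real)"
  have P[measurable]: "(\<lambda>(x, y). P x y) \<in> borel_measurable (M \<Otimes>\<^sub>M M)"
    unfolding P_def by measurable
  have W_lim: "(\<lambda>n. \<integral>\<^sup>+p. (case p of (x, y) \<Rightarrow> oscillation2 n W x y) \<partial>(M \<Otimes>\<^sub>M M)) \<longlonglongrightarrow> 0"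
    by (intro nn_integral_oscillation2_tendsto_0 oscillation_tendsto_0_superlevel W kernel_range col_res row_res) measurable
  \<comment> \<open>An indicator has the superlevel set \<open>{Q}\<close> for levels in [0, 1) and
    the empty set above. For \<open>P\<close> the former is the superlevel set of \<open>W\<close>
    at level 0.\<close>
  have P_level: "{x \<in> space M. q < of_bool (Q x)} \<in> resolved_sets"
    if "{x \<in> space M. Q x} \<in> resolved_sets" "0 \<le> q" for q :: real and Q
  proof (cases "q < 1")
    case True
    then have "{x \<in> space M. q < of_bool (Q x)} = {x \<in> space M. Q x}" using that(2) by auto
    with that show ?thesis by simp
  next
    case False
    then have empty: "{x \<in> space M. q < of_bool (Q x)} = {}" by auto
    have "{} \<in> resolved_sets" using sigma_algebra_resolved_sets by (simp add: sigma_algebra_iff2)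
    then show ?thesis unfolding empty .
  qed
  have P_col: "{x \<in> space M. q < P x y} \<in> resolved_sets" if "q \<in> \<rat>" "0 \<le> q" "y \<in> space M" for q y
    unfolding P_def using that by (intro P_level col_res) simp_all
  have P_row: "{y \<in> space M. q < P x y} \<in> resolved_sets" if "q \<in> \<rat>" "0 \<le> q" "x \<in> space M" for q x
    unfolding P_def using that by (intro P_level row_res) simp_all
  have P_range: "P x y \<in> {0..1}" for x y by (simp add: P_def)
  have P_lim: "(\<lambda>n. \<integral>\<^sup>+p. (case p of (x, y) \<Rightarrow> oscillation2 n P x y) \<partial>(M \<Otimes>\<^sub>M M)) \<longlonglongrightarrow> 0"
    by (intro nn_integral_oscillation2_tendsto_0 oscillation_tendsto_0_superlevel P P_range P_col P_row) measurable
  obtain r where r: "AE (x, y) in M \<Otimes>\<^sub>M M.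
      (\<lambda>k. oscillation2 (r k) W x y) \<longlonglongrightarrow> 0 \<and> (\<lambda>k. oscillation2 (r k) P x y) \<longlonglongrightarrow> 0"
    using exists_oscillation2_subsequence[OF W P W_lim P_lim] by blast
  have "\<exists>U. poset_kernel unit_interval (<) U \<and> (\<forall>x\<in>space M. \<forall>y\<in>space M. (W x y > 0 \<longrightarrow> f x < f y) \<longrightarrow> f x < 1 \<longrightarrow> f y < 1 \<longrightarrow>
      (\<lambda>k. oscillation2 (r k) W x y) \<longlonglongrightarrow> 0 \<longrightarrow> (\<lambda>k. oscillation2 (r k) P x y) \<longlonglongrightarrow> 0 \<longrightarrow> U (f x) (f y) = W x y)"
    unfolding P_def by (rule exists_cell_limit_kernel[OF W]; rule kernel_range kernel_trans; assumption)
  then obtain U where U: "poset_kernel unit_interval (<) U \<and> (\<forall>x\<in>space M. \<forall>y\<in>space M. (W x y > 0 \<longrightarrow> f x < f y) \<longrightarrow> f x < 1 \<longrightarrow> f y < 1 \<longrightarrow>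
      (\<lambda>k. oscillation2 (r k) W x y) \<longlonglongrightarrow> 0 \<longrightarrow> (\<lambda>k. oscillation2 (r k) P x y) \<longlonglongrightarrow> 0 \<longrightarrow> U (f x) (f y) = W x y)" ..
  note U_eq = U[THEN conjunct2, rule_format]
  \<comment> \<open>At the value 1 the cell has no mass, so averages there carry no
    information.\<close>
  have lt1: "AE x in M. f x < 1"
    using AE_f_neq[of 1] AE_space by eventually_elim (use range_f in force)
  have "AE p in M \<Otimes>\<^sub>M M. f (fst p) < 1"
    by (rule MM.AE_pair_measure) (use lt1 in auto)
  moreover have "AE p in M \<Otimes>\<^sub>M M. f (snd p) < 1"
    by (rule MM.AE_pair_measure) (use lt1 in auto)
  ultimately have "AE (x, y) in M \<Otimes>\<^sub>M M. W x y = pull_back U f x y"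
    using r mono AE_space
  proof eventually_elim
    case (elim p)
    obtain x y where p: "p = (x, y)" by (cases p)
    have xy: "x \<in> space M" "y \<in> space M" using elim by (auto simp: p space_pair_measure)
    \<comment> \<open>If \<open>W x y > 0\<close>, then \<open>lt x y\<close>, and off the
      exceptional null set this gives \<open>f x < f y\<close>, as \<open>U_eq\<close>
      demands.\<close>
    have "U (f x) (f y) = W x y"
      using elim kernel_pos_imp_lt[OF xy] U_eq[OF xy] by (simp add: p)
    then show ?case by (simp add: p pull_back_def)
  qed
  moreover have "poset_inclusion M lt unit_interval (<) f"
    unfolding poset_inclusion_def
  proof (intro conjI ordered_prob_space_axioms ordered_prob_space_unit_interval)
    show "measure_preserving M unit_interval f"
      by (intro measure_preserving_unit_intervalI measurable_f range_f cdf_f)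
    define B where "B = {p \<in> space (M \<Otimes>\<^sub>M M). case p of (x, y) \<Rightarrow> lt x y \<and> \<not> f x < f y}"
    have B: "B \<in> sets (M \<Otimes>\<^sub>M M)" unfolding B_def by measurable
    have "AE p in M \<Otimes>\<^sub>M M. p \<notin> B"
      using mono by eventually_elim (auto simp: B_def)
    then have "B \<in> null_sets (M \<Otimes>\<^sub>M M)" using AE_iff_null_sets[OF B] by simp
    also have "B = {(x, y). x \<in> space M \<and> y \<in> space M \<and> lt x y \<and> \<not> f x < f y}"
      by (auto simp: B_def space_pair_measure)
    finally show "{(x, y). x \<in> space M \<and> y \<in> space M \<and> lt x y \<and> \<not> f x < f y} \<in> null_sets (M \<Otimes>\<^sub>M M)" .
  qed
  ultimately show ?thesis using U by blast
qed

end
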